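(* Let $G=(V,E)$ be a bilayered directed acyclic graph, i.e. $V=U\cup W$ (disjoint) with $E\subseteq U\times W$, and let $\mathbf{a}\in\mathbb{R}^V_{\ge0}$. Consider the problem of finding a valid $\mathbf{x}$, i.e. $\mathbf{x}\in\mathbb{R}^V_{\ge0}$ with $x_w\ge\sum_{u\in C(w)}x_u$ for every $w\in W$, minimizing $\|\mathbf{x}-\mathbf{a}\|_1$. There is an algorithm that, given $\epsilon>0$, runs in time $O(|V||E|\log(|V|)/\epsilon^2)$ and returns a valid solution with objective value at most $(1+\epsilon)$ times the optimum.
   Context: For $w\in W$, $C(w)=\{u\in U:(u,w)\in E\}$ is the set of children of $w$.
   Formalization: The time bound is proved with min(1,ε) in place of ε, and if E is empty the bound is O(1+|V|) instead; the literal bound tends to 0 as ε grows and is 0 when E is empty, which no algorithm meets. Time is counted on a unit-cost real RAM. *)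

theory Defs
  imports Complex_Main
begin

section \<open>The optimisation problem\<close>

text \<open>Acyclicity follows from \<open>E \<subseteq> U \<times> W\<close> and \<open>U \<inter> W = {}\<close>: no directed path has length two.\<close>

definition bilayered :: "'v set \<Rightarrow> 'v set \<Rightarrow> ('v \<times> 'v) set \<Rightarrow> bool" where
  "bilayered U W E \<longleftrightarrow> finite U \<and> finite W \<and> U \<inter> W = {} \<and> E \<subseteq> U \<times> W"

definition children :: "'v set \<Rightarrow> ('v \<times> 'v) set \<Rightarrow> 'v \<Rightarrow> 'v set" where
  "children U E w = {u \<in> U. (u, w) \<in> E}"

text \<open>A vector indexed by the vertices is a function of which only the values on \<open>U \<union> W\<close> matter.\<close>

definition valid :: "'v set \<Rightarrow> 'v set \<Rightarrow> ('v \<times> 'v) set \<Rightarrow> ('v \<Rightarrow> real) \<Rightarrow> bool" where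
  "valid U W E x \<longleftrightarrow>
     (\<forall>v \<in> U \<union> W. x v \<ge> 0) \<and> (\<forall>w \<in> W. x w \<ge> (\<Sum>u \<in> children U E w. x u))"

definition l1_dist :: "'v set \<Rightarrow> ('v \<Rightarrow> real) \<Rightarrow> ('v \<Rightarrow> real) \<Rightarrow> real" where
  "l1_dist V x a = (\<Sum>v \<in> V. \<bar>x v - a v\<bar>)"

definition opt :: "'v set \<Rightarrow> 'v set \<Rightarrow> ('v \<times> 'v) set \<Rightarrow> ('v \<Rightarrow> real) \<Rightarrow> real" where
  "opt U W E a = (INF x \<in> {x. valid U W E x}. l1_dist (U \<union> W) x a)"

text \<open>The infimum is over a nonempty set that is bounded below, so it is the true one.\<close>

lemma valid_zero: "valid U W E (\<lambda>_. 0)"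
  by (simp add: valid_def)

lemma opt_le: "opt U W E a \<le> l1_dist (U \<union> W) x a" if "valid U W E x"
  unfolding opt_def
proof (rule cINF_lower)
  show "bdd_below ((\<lambda>x. l1_dist (U \<union> W) x a) ` {x. valid U W E x})"
    by (rule bdd_belowI[where m = 0]) (auto simp: l1_dist_def intro: sum_nonneg)
qed (use that in simp)

section \<open>The machine model: a real RAM\<close>

text \<open>
  Algorithms are while programs over two families of unbounded arrays, one holding natural
  numbers and one holding exact reals; cell \<open>i\<close> of array \<open>k\<close> is addressed by a constant
  \<open>k\<close> and a computed \<open>i\<close>. Every elementary operation has unit cost.
  The model is deliberately weak. Naturals can only be added, subtracted (truncated) and
  compared, so that no large numbers can be packed and unpacked; reals admit only the four
  arithmetic operations and comparison, there is no rounding and no conversion from reals to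
  naturals, and the constants of a program are rational. Division by zero yields zero.
\<close>

record mem =
  nats :: "nat \<Rightarrow> nat \<Rightarrow> nat"
  reals :: "nat \<Rightarrow> nat \<Rightarrow> real"

datatype nexp =
    NConst nat
  | NRead nat nexp
  | NPlus nexp nexp
  | NMinus nexp nexp

datatype rexp =
    RConst rat
  | RRead nat nexp
  | RPlus rexp rexp
  | RMinus rexp rexp
  | RTimes rexp rexp
  | RDivide rexp rexp

datatype bexp =
    NLess nexp nexp
  | RLess rexp rexp
  | BNot bexp
  | BAnd bexp bexp

datatype com =
    Skip
  | NWrite nat nexp nexp
  | RWrite nat nexp rexp
  | Seq com com
  | Cond bexp com com
  | While bexp com

primrec nval :: "mem \<Rightarrow> nexp \<Rightarrow> nat" where
  "nval s (NConst c) = c"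
| "nval s (NRead k i) = nats s k (nval s i)"
| "nval s (NPlus e f) = nval s e + nval s f"
| "nval s (NMinus e f) = nval s e - nval s f"

primrec rval :: "mem \<Rightarrow> rexp \<Rightarrow> real" where
  "rval s (RConst c) = of_rat c"
| "rval s (RRead k i) = reals s k (nval s i)"
| "rval s (RPlus e f) = rval s e + rval s f"
| "rval s (RMinus e f) = rval s e - rval s f"
| "rval s (RTimes e f) = rval s e * rval s f"
| "rval s (RDivide e f) = rval s e / rval s f"

primrec bval :: "mem \<Rightarrow> bexp \<Rightarrow> bool" where
  "bval s (NLess e f) \<longleftrightarrow> nval s e < nval s f"
| "bval s (RLess e f) \<longleftrightarrow> rval s e < rval s f"
| "bval s (BNot b) \<longleftrightarrow> \<not> bval s b"
| "bval s (BAnd b c) \<longleftrightarrow> bval s b \<and> bval s c"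

primrec ncost :: "nexp \<Rightarrow> nat" where
  "ncost (NConst c) = 1"
| "ncost (NRead k i) = 1 + ncost i"
| "ncost (NPlus e f) = 1 + ncost e + ncost f"
| "ncost (NMinus e f) = 1 + ncost e + ncost f"

primrec rcost :: "rexp \<Rightarrow> nat" where
  "rcost (RConst c) = 1"
| "rcost (RRead k i) = 1 + ncost i"
| "rcost (RPlus e f) = 1 + rcost e + rcost f"
| "rcost (RMinus e f) = 1 + rcost e + rcost f"
| "rcost (RTimes e f) = 1 + rcost e + rcost f"
| "rcost (RDivide e f) = 1 + rcost e + rcost f"

primrec bcost :: "bexp \<Rightarrow> nat" where
  "bcost (NLess e f) = 1 + ncost e + ncost f"
| "bcost (RLess e f) = 1 + rcost e + rcost f"
| "bcost (BNot b) = 1 + bcost b"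
| "bcost (BAnd b c) = 1 + bcost b + bcost c"

definition nwrite :: "nat \<Rightarrow> nat \<Rightarrow> nat \<Rightarrow> mem \<Rightarrow> mem" where
  "nwrite k i c s = s\<lparr>nats := (nats s)(k := (nats s k)(i := c))\<rparr>"

definition rwrite :: "nat \<Rightarrow> nat \<Rightarrow> real \<Rightarrow> mem \<Rightarrow> mem" where
  "rwrite k i c s = s\<lparr>reals := (reals s)(k := (reals s k)(i := c))\<rparr>"

text \<open>\<open>exec p s t s'\<close>: started in \<open>s\<close>, the program \<open>p\<close> halts in \<open>s'\<close> after exactly \<open>t\<close> operations.\<close>

inductive exec :: "com \<Rightarrow> mem \<Rightarrow> nat \<Rightarrow> mem \<Rightarrow> bool" where
  Skip: "exec Skip s 1 s"
| NWrite: "exec (NWrite k i e) s (1 + ncost i + ncost e) (nwrite k (nval s i) (nval s e) s)"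
| RWrite: "exec (RWrite k i e) s (1 + ncost i + rcost e) (rwrite k (nval s i) (rval s e) s)"
| Seq: "exec p s t s' \<Longrightarrow> exec q s' t' s'' \<Longrightarrow> exec (Seq p q) s (t + t') s''"
| CondTrue: "bval s b \<Longrightarrow> exec p s t s' \<Longrightarrow> exec (Cond b p q) s (1 + bcost b + t) s'"
| CondFalse: "\<not> bval s b \<Longrightarrow> exec q s t s' \<Longrightarrow> exec (Cond b p q) s (1 + bcost b + t) s'"
| WhileFalse: "\<not> bval s b \<Longrightarrow> exec (While b p) s (1 + bcost b) s"
| WhileTrue: "bval s b \<Longrightarrow> exec p s t s' \<Longrightarrow> exec (While b p) s' t' s'' \<Longrightarrow>
    exec (While b p) s (1 + bcost b + t + t') s''"

inductive_cases exec_SkipE: "exec Skip s t s'"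
  and exec_NWriteE: "exec (NWrite k i e) s t s'"
  and exec_RWriteE: "exec (RWrite k i e) s t s'"
  and exec_SeqE: "exec (Seq p q) s t s'"
  and exec_CondE: "exec (Cond b p q) s t s'"
  and exec_WhileE: "exec (While b p) s t s'"

lemma exec_deterministic:
  assumes "exec p s t s'" and "exec p s u s''"
  shows "u = t \<and> s'' = s'"
  using assms
proof (induction arbitrary: u s'' rule: exec.induct)
  case (Seq p s t s' q t' s2)
  from Seq.prems obtain t1 s1 t2 where
    "exec p s t1 s1" and "exec q s1 t2 s''" and "u = t1 + t2"
    by (rule exec_SeqE) auto
  with Seq.IH show ?case by blast
next
  case (CondTrue s b p t s' q)
  from CondTrue.prems obtain t1 where
    "exec p s t1 s''" and "u = 1 + bcost b + t1"
    by (rule exec_CondE) (use CondTrue.hyps(1) in auto)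
  with CondTrue.IH show ?case by blast
next
  case (CondFalse s b q t s' p)
  from CondFalse.prems obtain t1 where
    "exec q s t1 s''" and "u = 1 + bcost b + t1"
    by (rule exec_CondE) (use CondFalse.hyps(1) in auto)
  with CondFalse.IH show ?case by blast
next
  case (WhileFalse s b p)
  from WhileFalse.prems show ?case
    by (rule exec_WhileE) (use WhileFalse.hyps in auto)
next
  case (WhileTrue s b p t s' t' s2)
  from WhileTrue.prems obtain t1 s1 t2 where
    "exec p s t1 s1" and "exec (While b p) s1 t2 s''" and "u = 1 + bcost b + t1 + t2"
    by (rule exec_WhileE) (use WhileTrue.hyps(1) in auto)
  with WhileTrue.IH show ?case by blast
qed (auto elim: exec_SkipE exec_NWriteE exec_RWriteE)

section \<open>Input and output\<close>

text \<open>
  The graph is handed over as a list \<open>vs\<close> of its vertices and a list \<open>es\<close> of its edges, both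
  without repetition and in arbitrary order; an edge is a pair of positions in \<open>vs\<close>.
\<close>

definition encodes ::
  "'v list \<Rightarrow> (nat \<times> nat) list \<Rightarrow> 'v set \<Rightarrow> 'v set \<Rightarrow> ('v \<times> 'v) set \<Rightarrow> bool" where
  "encodes vs es U W E \<longleftrightarrow>
     distinct vs \<and> set vs = U \<union> W \<and>
     distinct es \<and> set es \<subseteq> {..<length vs} \<times> {..<length vs} \<and>
     (\<lambda>(i, j). (vs ! i, vs ! j)) ` set es = E"

definition load :: "'a \<Rightarrow> 'a list \<Rightarrow> nat \<Rightarrow> 'a" where
  "load d xs i = (if i < length xs then xs ! i else d)"

definition input ::
  "'v list \<Rightarrow> (nat \<times> nat) list \<Rightarrow> 'v set \<Rightarrow> ('v \<Rightarrow> real) \<Rightarrow> real \<Rightarrow> mem" where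
  "input vs es U a \<epsilon> =
     \<lparr>nats = load (\<lambda>_. 0)
        [load 0 [length vs, length es],
         load 0 (map (\<lambda>v. if v \<in> U then 1 else 0) vs),
         load 0 (map fst es),
         load 0 (map snd es)],
      reals = load (\<lambda>_. 0) [load 0 [\<epsilon>], load 0 (map a vs)]\<rparr>"

definition outputs :: "mem \<Rightarrow> 'v list \<Rightarrow> ('v \<Rightarrow> real) \<Rightarrow> bool" where
  "outputs s vs x \<longleftrightarrow> (\<forall>i < length vs. reals s 2 i = x (vs ! i))"

end

theory Submission
  imports Defs
begin

text \<open>
  A valid vector is obtained from \<open>a\<close> by lowering children and raising parents. If \<open>y v\<close> is the
  amount of change at \<open>v\<close>, this is the covering program of minimising the sum of \<open>y\<close> subject to
  \<open>y w + (\<Sum>u\<in>C(w). min (y u) (a u)) \<ge> (\<Sum>u\<in>C(w). a u) - a w\<close>; equivalently, with one linear constraint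
  for each \<open>w\<close> and each set of children assumed to be exhausted. It is solved by multiplicative
  weights in the manner of Garg, Koenemann and Fleischer: all weights \<open>X\<close> start at the largest right
  hand side, the scale \<open>\<alpha>\<close> grows by the factor \<open>b = 1 + O(\<epsilon>)\<close> in every phase, and \<open>X / \<alpha>\<close> is kept
  feasible by multiplying the weights in a violated row by \<open>b\<close>. As long as every \<open>X / \<alpha>\<close> seen costs
  at least \<open>\<beta>\<close>, the logarithm of the total weight grows slowly compared to the logarithms of the
  single weights averaged by any competitor; but after \<open>O(log |V| / \<epsilon>\<^sup>2)\<close> phases it must have grown
  almost as much as the logarithm of \<open>\<alpha>\<close>, which bounds the best \<open>\<beta>\<close>.
  The constraints are so homogeneous that one check of each row per phase suffices, and a check that
  scans the whole edge list costs \<open>O(|E|)\<close>.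
\<close>

section \<open>The multiplicative weights iteration\<close>

locale cover =
  fixes n :: nat and Ch :: "nat \<Rightarrow> nat set" and a :: "nat \<Rightarrow> real" and b :: real
  assumes Ch_sub: "Ch j \<subseteq> {..<n}"
    and Ch_irrefl: "j \<notin> Ch j"
    and a_nonneg: "i < n \<Longrightarrow> a i \<ge> 0"
    and b_gt_1: "b > 1"
begin

section \<open>Rows, sweeps and phases\<close>

text \<open>The maximum, over all sets \<open>S\<close> of children, of the sum of
  \<open>\<alpha> * a u - X u\<close> over \<open>S\<close>, so one inequality for
  \<open>excess\<close> bundles the linear constraints of all \<open>S\<close>. The amounts of
  change are \<open>X / \<alpha>\<close>; everything is multiplied through by the scale.\<close>

definition excess :: "(nat \<Rightarrow> real) \<Rightarrow> real \<Rightarrow> nat \<Rightarrow> real" where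
  "excess X \<alpha> j = (\<Sum>u\<in>Ch j. max 0 (\<alpha> * a u - X u))"

text \<open>A set at which the maximum in \<open>excess\<close> is attained, that is, the most
  violated linear constraint of row \<open>j\<close>.\<close>

definition active :: "(nat \<Rightarrow> real) \<Rightarrow> real \<Rightarrow> nat \<Rightarrow> nat set" where
  "active X \<alpha> j = {u \<in> Ch j. X u < \<alpha> * a u}"

definition row :: "(nat \<Rightarrow> real) \<Rightarrow> real \<Rightarrow> nat \<Rightarrow> nat \<Rightarrow> real" where
  "row X \<alpha> j =
     (if \<alpha> * a j + X j < excess X \<alpha> j
      then (\<lambda>v. if v = j \<or> v \<in> active X \<alpha> j then b * X v else X v) else X)"

text \<open>Each row is tested against weights already changed by the rows before it, so a single
  array can be updated in place.\<close>

primrec rows :: "(nat \<Rightarrow> real) \<Rightarrow> real \<Rightarrow> nat \<Rightarrow> nat \<Rightarrow> real" where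
  "rows X \<alpha> 0 = X"
| "rows X \<alpha> (Suc k) = row (rows X \<alpha> k) \<alpha> k"

primrec weights :: "(nat \<Rightarrow> real) \<Rightarrow> nat \<Rightarrow> nat \<Rightarrow> real" where
  "weights X 0 = X"
| "weights X (Suc t) = rows (weights X t) (b ^ Suc t) n"

text \<open>The bound \<open>k\<close> restricts the condition to the rows that a sweep has already
  visited.\<close>

definition feasible :: "(nat \<Rightarrow> real) \<Rightarrow> real \<Rightarrow> nat \<Rightarrow> bool" where
  "feasible X \<alpha> k \<longleftrightarrow> (\<forall>j<k. excess X \<alpha> j \<le> \<alpha> * a j + X j)"

abbreviation total :: "(nat \<Rightarrow> real) \<Rightarrow> real" where
  "total X \<equiv> \<Sum>v<n. X v"

abbreviation nonneg :: "(nat \<Rightarrow> real) \<Rightarrow> bool" where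
  "nonneg X \<equiv> \<forall>v. 0 \<le> X v"

lemma finite_Ch [simp]: "finite (Ch j)"
  using Ch_sub finite_subset by blast

lemma row_ge: "nonneg X \<Longrightarrow> X v \<le> row X \<alpha> j v"
  using b_gt_1 mult_right_mono[of 1 b "X v"] by (auto simp: row_def)

lemma rows_ge: "nonneg X \<Longrightarrow> X v \<le> rows X \<alpha> k v"
proof (induction k arbitrary: v)
  case (Suc k)
  have "nonneg (rows X \<alpha> k)"
    using Suc by (meson order_trans)
  then show ?case
    using Suc row_ge[of "rows X \<alpha> k" v \<alpha> k] order_trans by (metis rows.simps(2))
qed simp

lemma rows_nonneg: "nonneg X \<Longrightarrow> nonneg (rows X \<alpha> k)"
  using rows_ge by (meson order_trans)

lemma weights_ge: "nonneg X \<Longrightarrow> X v \<le> weights X t v"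
proof (induction t arbitrary: v)
  case (Suc t)
  have "nonneg (weights X t)"
    using Suc by (meson order_trans)
  then show ?case
    using Suc rows_ge[of "weights X t" v "b ^ Suc t" n] order_trans by (metis weights.simps(2))
qed simp

lemma weights_nonneg: "nonneg X \<Longrightarrow> nonneg (weights X t)"
  using weights_ge by (meson order_trans)

section \<open>Feasibility after every phase\<close>

lemma excess_antimono: "(\<And>v. X v \<le> Y v) \<Longrightarrow> excess Y \<alpha> j \<le> excess X \<alpha> j"
  unfolding excess_def by (intro sum_mono max.mono) auto

text \<open>A single update repairs a row that was satisfied one scale earlier, because the row
  constraint is homogeneous in the scale and the active weights.\<close>

lemma row_repairs:
  assumes "excess Z \<alpha> j \<le> \<alpha> * a j + Z j" and "\<And>v. Z v \<le> X v" and "nonneg Z"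
  shows "excess (row X (b * \<alpha>) j) (b * \<alpha>) j \<le> b * \<alpha> * a j + row X (b * \<alpha>) j j"
proof (cases "b * \<alpha> * a j + X j < excess X (b * \<alpha>) j")
  case True
  let ?Y = "row X (b * \<alpha>) j"
  have le: "b * Z v \<le> b * X v" for v
    using assms(2) b_gt_1 by simp
  have "max 0 (b * \<alpha> * a u - ?Y u) \<le> b * max 0 (\<alpha> * a u - Z u)" if "u \<in> Ch j" for u
  proof (cases "X u < b * \<alpha> * a u")
    case True': True
    then have "?Y u = b * X u"
      using True that by (simp add: row_def active_def)
    then have "b * \<alpha> * a u - ?Y u \<le> b * (\<alpha> * a u - Z u)"
      using le[of u] by (simp add: algebra_simps)
    also have "\<dots> \<le> b * max 0 (\<alpha> * a u - Z u)"
      using b_gt_1 by (intro mult_left_mono) auto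
    finally show ?thesis
      using b_gt_1 by simp
  next
    case False
    have "nonneg X"
      using assms(2,3) by (meson order_trans)
    then have "X u \<le> ?Y u"
      by (rule row_ge)
    then show ?thesis
      using False b_gt_1 by simp
  qed
  then have "excess ?Y (b * \<alpha>) j \<le> b * excess Z \<alpha> j"
    unfolding excess_def sum_distrib_left by (intro sum_mono) simp
  also have "\<dots> \<le> b * (\<alpha> * a j + Z j)"
    using assms(1) b_gt_1 by simp
  also have "\<dots> \<le> b * \<alpha> * a j + ?Y j"
    using True le[of j] by (simp add: row_def algebra_simps)
  finally show ?thesis .
next
  case False
  then show ?thesis
    by (simp add: row_def)
qed

text \<open>Rows visited earlier in the sweep stay satisfied, because growing weights lower the
  excess and raise the right-hand side. The row being visited is compared with \<open>X\<close>, the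
  weights before the sweep, which satisfied it at scale \<open>\<alpha>\<close>.\<close>

lemma rows_feasible:
  assumes "feasible X \<alpha> n" and "nonneg X" and "k \<le> n"
  shows "feasible (rows X (b * \<alpha>) k) (b * \<alpha>) k"
  using assms(3)
proof (induction k)
  case 0
  then show ?case
    by (simp add: feasible_def)
next
  case (Suc k)
  let ?Y = "rows X (b * \<alpha>) k"
  have ge: "?Y v \<le> row ?Y (b * \<alpha>) k v" for v
    using row_ge rows_nonneg assms(2) by blast
  have "excess (row ?Y (b * \<alpha>) k) (b * \<alpha>) j \<le> b * \<alpha> * a j + row ?Y (b * \<alpha>) k j"
    if "j < k" for j
    using excess_antimono[of ?Y "row ?Y (b * \<alpha>) k" "b * \<alpha>" j] ge[of j] ge Suc that
    by (fastforce simp: feasible_def)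
  moreover have "excess (row ?Y (b * \<alpha>) k) (b * \<alpha>) k \<le> b * \<alpha> * a k + row ?Y (b * \<alpha>) k k"
    by (rule row_repairs[where Z = X])
      (use assms Suc.prems rows_ge in \<open>auto simp: feasible_def\<close>)
  ultimately show ?case
    by (auto simp: feasible_def less_Suc_eq)
qed

lemma weights_feasible:
  assumes "feasible X 1 n" and "nonneg X"
  shows "feasible (weights X t) (b ^ t) n"
proof (induction t)
  case (Suc t)
  then show ?case
    using rows_feasible[OF Suc weights_nonneg[OF assms(2)] order_refl] by simp
qed (use assms in simp)

section \<open>Initial weights and a lower bound on the total weight\<close>

text \<open>The largest right-hand side, cut off at 0. It is written with the excess of the zero
  vector at scale 1 because the program finds it with the same scan that checks rows;
  \<open>k\<close> is the loop index.\<close>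

definition max_excess :: "nat \<Rightarrow> real" where
  "max_excess k = Max (insert 0 ((\<lambda>j. excess (\<lambda>_. 0) 1 j - a j) ` {..<k}))"

lemma max_excess_simps:
  "max_excess 0 = 0"
  "max_excess (Suc k) = max (excess (\<lambda>_. 0) 1 k - a k) (max_excess k)"
  by (simp_all add: max_excess_def lessThan_Suc insert_commute[of 0])

lemma max_excess_nonneg: "0 \<le> max_excess k"
  by (simp add: max_excess_def)

lemma excess_0: "excess (\<lambda>_. 0) 1 j = sum a (Ch j)"
  unfolding excess_def using Ch_sub a_nonneg by (intro sum.cong) (force intro: max_absorb2)+

lemma le_max_excess: "j < n \<Longrightarrow> sum a (Ch j) - a j \<le> max_excess n"
  unfolding max_excess_def excess_0 by (rule Max_ge) auto

lemma max_excess_attained: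
  assumes "max_excess n > 0"
  obtains j where "j < n" and "max_excess n = sum a (Ch j) - a j"
proof -
  have "max_excess n \<in> insert 0 ((\<lambda>j. excess (\<lambda>_. 0) 1 j - a j) ` {..<n})"
    unfolding max_excess_def by (rule Max_in) auto
  then show ?thesis
    using assms that by (auto simp: excess_0)
qed

text \<open>The weight of \<open>j\<close> alone then satisfies row \<open>j\<close> at scale 1. The
  value 0 outside the index range is that of memory cells never written.\<close>

definition start :: "nat \<Rightarrow> real" where
  "start v = (if v < n then max_excess n else 0)"

lemma start_nonneg: "nonneg start"
  using max_excess_nonneg by (simp add: start_def)

lemma start_feasible: "feasible start 1 n"
proof -
  have "excess start 1 j \<le> 1 * a j + start j" if "j < n" for j
  proof -
    have "excess start 1 j \<le> excess (\<lambda>_. 0) 1 j"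
      using start_nonneg by (intro excess_antimono) auto
    then show ?thesis
      using le_max_excess[OF that] that by (simp add: start_def excess_0)
  qed
  then show ?thesis
    by (simp add: feasible_def)
qed

text \<open>The row attaining \<open>max_excess n\<close> alone forces this much weight onto its
  vertex and its children. Hence the total weight grows at least like the scale.\<close>

lemma total_ge_max_excess:
  assumes "feasible X \<alpha> n" and "nonneg X" and "0 \<le> \<alpha>"
  shows "\<alpha> * max_excess n \<le> total X"
proof (cases "max_excess n > 0")
  case True
  then obtain j where j: "j < n" "max_excess n = sum a (Ch j) - a j"
    by (rule max_excess_attained)
  have "\<alpha> * sum a (Ch j) - sum X (Ch j) \<le> excess X \<alpha> j"
    unfolding excess_def sum_distrib_left sum_subtractf[symmetric] by (rule sum_mono) simp
  also have "\<dots> \<le> \<alpha> * a j + X j"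
    using assms j by (simp add: feasible_def)
  finally have "\<alpha> * max_excess n \<le> X j + sum X (Ch j)"
    by (simp add: j algebra_simps)
  also have "\<dots> = sum X (insert j (Ch j))"
    using Ch_irrefl by simp
  also have "\<dots> \<le> total X"
    using assms Ch_sub j by (intro sum_mono2) auto
  finally show ?thesis .
next
  case False
  then have "max_excess n = 0"
    using max_excess_nonneg[of n] by linarith
  then show ?thesis
    using assms by (simp add: sum_nonneg)
qed

section \<open>Upper bounds for single weights\<close>

text \<open>On the active set the truncation at 0 disappears, and a violated row becomes a plain
  linear inequality. It limits both the size of a weight before an update and the growth of the
  total.\<close>

lemma active_sum_less:
  assumes "\<alpha> * a j + X j < excess X \<alpha> j"
  shows "sum X (insert j (active X \<alpha> j)) < \<alpha> * (sum a (active X \<alpha> j) - a j)"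
proof -
  have "excess X \<alpha> j = (\<Sum>u\<in>active X \<alpha> j. max 0 (\<alpha> * a u - X u))"
    unfolding excess_def active_def by (rule sum.mono_neutral_right) auto
  also have "\<dots> = (\<Sum>u\<in>active X \<alpha> j. \<alpha> * a u - X u)"
    by (rule sum.cong) (auto simp: active_def)
  also have "\<dots> = \<alpha> * sum a (active X \<alpha> j) - sum X (active X \<alpha> j)"
    by (simp add: sum_subtractf sum_distrib_left)
  finally have "excess X \<alpha> j = \<alpha> * sum a (active X \<alpha> j) - sum X (active X \<alpha> j)" .
  moreover have "sum X (insert j (active X \<alpha> j)) = X j + sum X (active X \<alpha> j)"
    using Ch_irrefl by (simp add: active_def)
  ultimately show ?thesis
    using assms by (simp add: algebra_simps)
qed

text \<open>A weight is multiplied only in a violated row, where all affected weights together stay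
  below \<open>\<alpha> * max_excess n\<close>; one factor \<open>b\<close> is the whole
  overshoot.\<close>

lemma row_le:
  assumes "j < n" and "nonneg X" and "0 \<le> \<alpha>" and "\<And>v. X v \<le> b * \<alpha> * max_excess n"
  shows "row X \<alpha> j v \<le> b * \<alpha> * max_excess n"
proof (cases "\<alpha> * a j + X j < excess X \<alpha> j \<and> v \<in> insert j (active X \<alpha> j)")
  case True
  have sub: "active X \<alpha> j \<subseteq> Ch j" "finite (active X \<alpha> j)"
    by (auto simp: active_def)
  have "X v \<le> sum X (insert j (active X \<alpha> j))"
    using True assms(2) sub(2) by (intro member_le_sum) auto
  also have "\<dots> \<le> \<alpha> * (sum a (active X \<alpha> j) - a j)"
    using active_sum_less True by (simp add: less_imp_le)
  also have "\<dots> \<le> \<alpha> * (sum a (Ch j) - a j)"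
    using sub assms(3) Ch_sub a_nonneg
    by (intro mult_left_mono diff_right_mono sum_mono2) auto
  also have "\<dots> \<le> \<alpha> * max_excess n"
    using assms le_max_excess by (intro mult_left_mono) auto
  finally have "b * X v \<le> b * (\<alpha> * max_excess n)"
    using b_gt_1 by simp
  then show ?thesis
    using True by (auto simp: row_def)
next
  case False
  then show ?thesis
    using assms(4) by (auto simp: row_def)
qed

lemma rows_le:
  assumes "k \<le> n" and "nonneg X" and "0 \<le> \<alpha>" and "\<And>v. X v \<le> b * \<alpha> * max_excess n"
  shows "rows X \<alpha> k v \<le> b * \<alpha> * max_excess n"
  using assms(1)
proof (induction k arbitrary: v)
  case (Suc k)
  then show ?case
    using row_le rows_nonneg[OF assms(2)] assms(3) by simp
qed (use assms in simp)

lemma weights_le: "weights start t v \<le> b ^ Suc t * max_excess n"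
proof (induction t arbitrary: v)
  case 0
  have "max_excess n \<le> b * max_excess n"
    using mult_right_mono[of 1 b "max_excess n"] b_gt_1 max_excess_nonneg by simp
  moreover have "0 \<le> b * max_excess n"
    using max_excess_nonneg b_gt_1 by simp
  ultimately show ?case
    by (simp add: start_def)
next
  case (Suc t)
  have "b ^ Suc t * max_excess n \<le> b * b ^ Suc t * max_excess n"
    using mult_right_mono[of 1 b "b ^ Suc t * max_excess n"] b_gt_1 max_excess_nonneg
    by (simp add: mult.assoc)
  then have "weights start t v \<le> b * b ^ Suc t * max_excess n" for v
    using Suc order_trans by blast
  then show ?case
    using rows_le[of n "weights start t" "b ^ Suc t"] weights_nonneg[OF start_nonneg] b_gt_1
    by simp
qed

section \<open>Weak duality and the potential\<close>

text \<open>Validity in terms of positions. The second condition ranges over all vertices; without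
  children it reduces to nonnegativity.\<close>

definition admissible :: "(nat \<Rightarrow> real) \<Rightarrow> bool" where
  "admissible z \<longleftrightarrow> (\<forall>v<n. 0 \<le> z v) \<and> (\<forall>j<n. sum z (Ch j) \<le> z j)"

definition cost :: "(nat \<Rightarrow> real) \<Rightarrow> real" where
  "cost z = (\<Sum>v<n. \<bar>z v - a v\<bar>)"

text \<open>Weak duality for a single row: the children outside the active set contribute
  nonnegatively to any admissible vector, so they can be dropped.\<close>

lemma admissible_row:
  assumes "admissible z" and "j < n"
  shows "sum a (active X \<alpha> j) - a j \<le> (\<Sum>v\<in>insert j (active X \<alpha> j). \<bar>z v - a v\<bar>)"
proof -
  have sub: "active X \<alpha> j \<subseteq> Ch j" "finite (active X \<alpha> j)"
    by (auto simp: active_def)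
  have "sum a (active X \<alpha> j) \<le> (\<Sum>v\<in>active X \<alpha> j. z v + \<bar>z v - a v\<bar>)"
    by (rule sum_mono) simp
  also have "\<dots> = sum z (active X \<alpha> j) + (\<Sum>v\<in>active X \<alpha> j. \<bar>z v - a v\<bar>)"
    by (rule sum.distrib)
  also have "sum z (active X \<alpha> j) \<le> sum z (Ch j)"
    using sub assms Ch_sub by (intro sum_mono2) (auto simp: admissible_def)
  also have "sum z (Ch j) \<le> z j"
    using assms by (simp add: admissible_def)
  also have "z j \<le> a j + \<bar>z j - a j\<bar>"
    by simp
  finally show ?thesis
    using sub Ch_irrefl[of j] by (subst sum.insert) auto
qed

text \<open>Compares the logarithm of the total weight with the logarithms of single weights
  averaged by the competitor's changes. In an update the first term gains at most
  \<open>(b - 1) * b\<close> per unit of affected change, and each affected logarithm gains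
  \<open>ln b\<close>; the coefficient balances the two.\<close>

definition potential :: "real \<Rightarrow> (nat \<Rightarrow> real) \<Rightarrow> (nat \<Rightarrow> real) \<Rightarrow> real" where
  "potential \<beta> z X =
     \<beta> * ln (total X) - (b - 1) * b / ln b * (\<Sum>v<n. \<bar>z v - a v\<bar> * ln (X v))"

text \<open>An update on \<open>A\<close> raises \<open>ln (total X)\<close> by at most
  \<open>(b - 1) * sum X A / total X\<close>. Violation and weak duality bound
  \<open>sum X A\<close> by \<open>\<alpha>\<close> times the competitor's change on
  \<open>A\<close>, and the hypothesis on \<open>\<beta>\<close> turns this into what the second
  term takes away. The factor \<open>b\<close> there allows \<open>\<beta>\<close> to be tested at
  the previous scale.\<close>

lemma row_potential:
  assumes "admissible z" and "j < n" and pos: "\<And>v. v < n \<Longrightarrow> 0 < X v"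
    and \<beta>: "0 \<le> \<beta>" "\<beta> * \<alpha> \<le> b * total X" and "0 \<le> \<alpha>"
  shows "potential \<beta> z (row X \<alpha> j) \<le> potential \<beta> z X"
proof (cases "\<alpha> * a j + X j < excess X \<alpha> j")
  case True
  define A where "A = insert j (active X \<alpha> j)"
  define y where "y v = \<bar>z v - a v\<bar>" for v
  have A: "A \<subseteq> {..<n}"
    using Ch_sub assms(2) by (auto simp: A_def active_def)
  have row: "row X \<alpha> j v = (if v \<in> A then b * X v else X v)" for v
    using True by (auto simp: row_def A_def)
  have tot_pos: "0 < total X"
    using assms(2) pos by (intro sum_pos) auto
  have sums: "(\<Sum>v<n. f v + (if v \<in> A then g v else 0)) = sum f {..<n} + sum g A"
    for f g :: "nat \<Rightarrow> real"
    using A by (simp add: sum.distrib sum.If_cases Int_absorb1)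
  have tot: "total (row X \<alpha> j) = total X + (b - 1) * sum X A"
    unfolding sum_distrib_left sums[symmetric] by (rule sum.cong) (auto simp: row algebra_simps)
  have "sum X A \<le> \<alpha> * (sum a (active X \<alpha> j) - a j)"
    unfolding A_def using active_sum_less[OF True] by simp
  also have "\<dots> \<le> \<alpha> * sum y A"
    unfolding A_def y_def using admissible_row assms by (intro mult_left_mono) auto
  finally have XA: "sum X A \<le> \<alpha> * sum y A" .
  have XA_nonneg: "0 \<le> sum X A"
    using A pos by (intro sum_nonneg) (auto intro: less_imp_le)
  have "ln (total (row X \<alpha> j)) - ln (total X) = ln (1 + (b - 1) * sum X A / total X)"
    unfolding tot using tot_pos XA_nonneg b_gt_1
      ln_divide_pos[of "total X + (b - 1) * sum X A" "total X"]
    by (simp add: add_pos_nonneg add_divide_distrib)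
  also have "\<dots> \<le> (b - 1) * sum X A / total X"
    using tot_pos XA_nonneg b_gt_1 by (intro ln_add_one_self_le_self) simp
  also have "\<dots> \<le> (b - 1) * (\<alpha> * sum y A) / total X"
    using tot_pos XA b_gt_1 by (intro divide_right_mono mult_left_mono) auto
  finally have "\<beta> * (ln (total (row X \<alpha> j)) - ln (total X))
      \<le> \<beta> * ((b - 1) * (\<alpha> * sum y A) / total X)"
    using \<beta>(1) by (rule mult_left_mono)
  also have "\<dots> = (\<beta> * \<alpha>) * ((b - 1) * sum y A / total X)"
    by simp
  also have "\<dots> \<le> (b * total X) * ((b - 1) * sum y A / total X)"
    using \<beta>(2) b_gt_1 tot_pos
    by (intro mult_right_mono divide_nonneg_pos mult_nonneg_nonneg sum_nonneg) (auto simp: y_def)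
  also have "\<dots> = (b - 1) * b / ln b * (\<Sum>v\<in>A. y v * ln b)"
    using tot_pos b_gt_1 by (simp add: sum_distrib_right[symmetric])
  also have "(\<Sum>v\<in>A. y v * ln b)
      = (\<Sum>v<n. y v * ln (row X \<alpha> j v)) - (\<Sum>v<n. y v * ln (X v))"
  proof -
    have "(\<Sum>v<n. y v * ln (row X \<alpha> j v))
        = (\<Sum>v<n. y v * ln (X v) + (if v \<in> A then y v * ln b else 0))"
    proof (rule sum.cong)
      fix v assume "v \<in> {..<n}"
      then have "0 < X v"
        using pos by simp
      then show "y v * ln (row X \<alpha> j v) = y v * ln (X v) + (if v \<in> A then y v * ln b else 0)"
        using b_gt_1 by (simp add: row ln_mult algebra_simps)
    qed simp
    then show ?thesis
      by (simp add: sums)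
  qed
  finally show ?thesis
    by (simp add: potential_def y_def algebra_simps)
next
  case False
  then show ?thesis
    by (simp add: row_def)
qed

lemma rows_potential:
  assumes "admissible z" and "nonneg X" and "\<And>v. v < n \<Longrightarrow> 0 < X v"
    and "0 \<le> \<beta>" "\<beta> * \<alpha> \<le> b * total X" and "0 \<le> \<alpha>" and "k \<le> n"
  shows "potential \<beta> z (rows X \<alpha> k) \<le> potential \<beta> z X"
  using assms(7)
proof (induction k)
  case (Suc k)
  have "total X \<le> total (rows X \<alpha> k)"
    using rows_ge[OF assms(2)] by (intro sum_mono)
  then have "b * total X \<le> b * total (rows X \<alpha> k)"
    using b_gt_1 by simp
  moreover have "0 < rows X \<alpha> k v" if "v < n" for v
    using rows_ge[OF assms(2)] assms(3)[OF that] by (rule less_le_trans[rotated])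
  ultimately have "potential \<beta> z (rows X \<alpha> (Suc k)) \<le> potential \<beta> z (rows X \<alpha> k)"
    unfolding rows.simps using assms Suc.prems by (intro row_potential) auto
  then show ?case
    using Suc by simp
qed simp

lemma weights_potential:
  assumes "admissible z" and "max_excess n > 0"
    and "0 \<le> \<beta>" "\<And>s. s < t \<Longrightarrow> \<beta> * b ^ s \<le> total (weights start s)"
  shows "potential \<beta> z (weights start t) \<le> potential \<beta> z start"
  using assms(4)
proof (induction t)
  case (Suc t)
  have pos: "0 < weights start t v" if "v < n" for v
    using weights_ge[OF start_nonneg, of v t] that assms(2) start_def[of v] by simp
  \<comment> \<open>The hypothesis speaks of the old scale \<open>b ^ t\<close>, but the sweep runs
    at \<open>b ^ Suc t\<close>; this costs the factor \<open>b\<close>.\<close>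
  have "\<beta> * b ^ t \<le> total (weights start t)"
    using Suc.prems[of t] by simp
  then have "\<beta> * b ^ Suc t \<le> b * total (weights start t)"
    using mult_left_mono[of "\<beta> * b ^ t" "total (weights start t)" b] b_gt_1
    by (simp add: mult.left_commute)
  then have "potential \<beta> z (weights start (Suc t)) \<le> potential \<beta> z (weights start t)"
    unfolding weights.simps using assms pos b_gt_1 weights_nonneg[OF start_nonneg]
    by (intro rows_potential) auto
  also have "\<dots> \<le> potential \<beta> z start"
    using Suc by simp
  finally show ?case .
qed simp

section \<open>The approximation ratio\<close>

text \<open>With \<open>\<sigma> = max_excess n\<close>, the total weight is
  \<open>n * \<sigma>\<close> at the start and at least \<open>b ^ t * \<sigma>\<close> after
  \<open>t\<close> phases, while each single weight is at most \<open>b ^ Suc t * \<sigma>\<close>.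
  Substituted into the nonincreasing potential, \<open>ln \<sigma>\<close> and the division by
  \<open>ln b\<close> cancel.\<close>

lemma best_scale:
  assumes z: "admissible z" and pos: "max_excess n > 0"
    and \<beta>: "0 \<le> \<beta>" "\<And>s. s < t \<Longrightarrow> \<beta> * b ^ s \<le> total (weights start s)"
  shows "\<beta> * (real t * ln b - ln n) \<le> (b - 1) * b * (real t + 1) * cost z"
proof -
  define \<sigma> where "\<sigma> = max_excess n"
  define X where "X = weights start t"
  define y where "y v = \<bar>z v - a v\<bar>" for v
  have n: "0 < n"
    using pos max_excess_simps(1) by (metis less_irrefl gr0I)
  have \<sigma>: "0 < \<sigma>"
    using pos by (simp add: \<sigma>_def)
  have start: "start v = \<sigma>" if "v < n" for v
    using that by (simp add: start_def \<sigma>_def)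
  have tot_start: "total start = n * \<sigma>"
    using start by simp
  have X_pos: "0 < X v" if "v < n" for v
    using weights_ge[OF start_nonneg, of v t] start[OF that] \<sigma> by (simp add: X_def)
  have "b ^ t * \<sigma> \<le> total X"
    unfolding \<sigma>_def X_def using b_gt_1
    by (intro total_ge_max_excess weights_feasible weights_nonneg start_feasible start_nonneg) simp
  then have "ln (b ^ t * \<sigma>) \<le> ln (total X)"
    using \<sigma> b_gt_1 by (intro ln_mono) auto
  then have "\<beta> * (real t * ln b + ln \<sigma>) \<le> \<beta> * ln (total X)"
    using \<beta>(1) \<sigma> b_gt_1 by (intro mult_left_mono) (auto simp: ln_mult ln_realpow)
  moreover have "\<beta> * ln (total start) = \<beta> * (ln n + ln \<sigma>)"
    using n \<sigma> tot_start by (simp add: ln_mult)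
  moreover have "potential \<beta> z X \<le> potential \<beta> z start"
    unfolding X_def by (rule weights_potential) (use assms in auto)
  ultimately have "\<beta> * (real t * ln b - ln n) \<le> (b - 1) * b / ln b *
      ((\<Sum>v<n. y v * ln (X v)) - (\<Sum>v<n. y v * ln (start v)))"
    by (simp add: potential_def y_def algebra_simps)
  also have "\<dots> \<le> (b - 1) * b / ln b * ((real t + 1) * ln b * cost z)"
  proof (rule mult_left_mono)
    have "ln (X v) - ln \<sigma> \<le> (real t + 1) * ln b" if "v < n" for v
    proof -
      have "ln (X v) \<le> ln (b ^ Suc t * \<sigma>)"
        using X_pos[OF that] weights_le[of t v] by (intro ln_mono) (auto simp: X_def \<sigma>_def)
      then show ?thesis
        using \<sigma> b_gt_1 by (simp add: ln_mult ln_realpow algebra_simps)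
    qed
    then have "(\<Sum>v<n. y v * (ln (X v) - ln (start v))) \<le> (\<Sum>v<n. y v * ((real t + 1) * ln b))"
      by (intro sum_mono mult_left_mono) (auto simp: start y_def)
    then show "(\<Sum>v<n. y v * ln (X v)) - (\<Sum>v<n. y v * ln (start v)) \<le> (real t + 1) * ln b * cost z"
      by (simp add: cost_def y_def sum_subtractf right_diff_distrib sum_distrib_left mult_ac)
  qed (use b_gt_1 in simp)
  also have "\<dots> = (b - 1) * b * (real t + 1) * cost z"
    using b_gt_1 by (simp add: field_simps)
  finally show ?thesis .
qed

text \<open>With \<open>e = b - 1\<close>, the condition on \<open>t\<close> makes
  \<open>ln n\<close> at most the fraction \<open>e\<close> of \<open>t * e / (1 + e)\<close>, a
  lower bound for \<open>t * ln b\<close>. So the left side of \<open>best_scale\<close> loses only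
  a factor \<open>1 - e\<close>.\<close>

lemma approximation:
  assumes z: "admissible z" and b: "b \<le> 7 / 6"
    and n: "n \<le> 2 ^ l" "1 \<le> n" "1 \<le> l" and t: "2 * real l \<le> real t * (b - 1)\<^sup>2"
    and \<beta>: "0 \<le> \<beta>" "\<And>s. s < t \<Longrightarrow> \<beta> * b ^ s \<le> total (weights start s)"
  shows "\<beta> \<le> (1 + 6 * (b - 1)) * cost z"
proof -
  define e where "e = b - 1"
  have e: "0 < e" "e \<le> 1 / 6" and b_eq: "b = 1 + e"
    using b b_gt_1 by (auto simp: e_def)
  have cost: "0 \<le> cost z"
    by (simp add: cost_def sum_nonneg)
  have t2: "2 \<le> real t * e * e"
    using t n(3) by (simp add: e_def power2_eq_square mult.assoc)
  then have t_pos: "0 < t"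
    by (cases t) auto
  show ?thesis
  proof (cases "max_excess n > 0")
    case True
    have "ln (real n) \<le> ln (2 ^ l)"
      using n by (intro ln_mono) (auto simp flip: of_nat_power)
    also have "\<dots> = l * ln 2"
      by (simp add: ln_realpow)
    also have "\<dots> \<le> l"
      using ln_2_less_1 by (simp add: mult_left_le)
    also have "\<dots> \<le> real t * e * (e / 2)"
      using t by (simp add: e_def power2_eq_square mult.assoc)
    also have "\<dots> \<le> real t * e * (e / (1 + e))"
      using e by (intro mult_left_mono divide_left_mono) auto
    finally have "ln (real n) \<le> e * (real t * (e / (1 + e)))"
      by (simp add: mult_ac)
    moreover have "e / (1 + e) = 1 - inverse b"
      using e by (simp add: b_eq field_simps)
    then have "real t * (e / (1 + e)) \<le> real t * ln b"
      using ln_le_minus_one[of "inverse b"] b_gt_1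
      by (intro mult_left_mono) (simp_all add: ln_inverse del: inverse_eq_divide)
    ultimately have "(1 - e) * (real t * (e / (1 + e))) \<le> real t * ln b - ln n"
      unfolding left_diff_distrib by linarith
    then have "\<beta> * ((1 - e) * (real t * (e / (1 + e)))) \<le> \<beta> * (real t * ln b - ln n)"
      using \<beta>(1) by (rule mult_left_mono)
    also have "\<dots> \<le> e * (1 + e) * (real t + 1) * cost z"
      using best_scale[OF z True \<beta>] by (simp add: b_eq)
    \<comment> \<open>As \<open>t * e \<ge> 1\<close>, the summand 1 in \<open>t + 1\<close> is
      absorbed into \<open>t * (1 + e)\<close>.\<close>
    also have "\<dots> \<le> e * (1 + e) * (real t * (1 + e)) * cost z"
    proof -
      have "1 \<le> real t * e"
        using t2 e mult_left_mono[of e 1 "real t * e"] by simp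
      then show ?thesis
        using e cost by (intro mult_right_mono mult_left_mono) (auto simp: algebra_simps)
    qed
    finally have "(e * real t) * (\<beta> * (1 - e)) \<le> (e * real t) * ((1 + e) ^ 3 * cost z)"
      using e by (simp add: field_simps power3_eq_cube)
    then have "\<beta> * (1 - e) \<le> (1 + e) ^ 3 * cost z"
      using e t_pos by simp
    \<comment> \<open>The constants 6 and \<open>7 / 6\<close> serve the inequality
      \<open>(1 + e)^3 \<le> (1 + 6 * e) * (1 - e)\<close>, valid for
      \<open>0 < e \<le> 1 / 6\<close>.\<close>
    also have "\<dots> \<le> (1 + 6 * e) * cost z * (1 - e)"
    proof -
      have "e * e \<le> e * (1 / 6)"
        using e by (intro mult_left_mono) auto
      moreover from this have "e * (e * e) \<le> e * (1 / 6)"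
        using e by (intro mult_left_mono) linarith+
      moreover have "(1 + 6 * e) * (1 - e) - (1 + e) ^ 3 = 2 * e - 9 * (e * e) - e * (e * e)"
        by (simp add: power3_eq_cube algebra_simps)
      ultimately have "(1 + e) ^ 3 \<le> (1 + 6 * e) * (1 - e)"
        using e by linarith
      then show ?thesis
        using cost mult_right_mono by (fastforce simp: mult_ac)
    qed
    finally show ?thesis
      using e by (simp add: e_def)
  next
    case False
    then have "max_excess n = 0"
      using max_excess_nonneg[of n] by linarith
    \<comment> \<open>All initial weights are 0 here, so the hypothesis at phase 0 already settles
      the claim.\<close>
    then have "\<beta> \<le> 0"
      using \<beta>(2)[OF t_pos] \<beta>(2)[of 0] t_pos by (simp add: start_def)
    also have "0 \<le> (1 + 6 * (b - 1)) * cost z"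
      using cost b_gt_1 by simp
    finally show ?thesis .
  qed
qed

section \<open>Valid vectors from feasible weights\<close>

text \<open>The vertices in \<open>I\<close>, later the layer \<open>U\<close>, are lowered and all
  others raised. Lowering stops at 0, which corresponds to the truncation in
  \<open>excess\<close>.\<close>

definition candidate :: "nat set \<Rightarrow> (nat \<Rightarrow> real) \<Rightarrow> real \<Rightarrow> nat \<Rightarrow> real" where
  "candidate I X \<alpha> v = (if v \<in> I then max 0 (a v - X v / \<alpha>) else a v + X v / \<alpha>)"

text \<open>The lowered values of the children add up to exactly
  \<open>excess X \<alpha> j / \<alpha>\<close>, so feasibility of the weights is the constraint at
  \<open>j\<close>.\<close>

lemma candidate_admissible:
  assumes "feasible X \<alpha> n" and "nonneg X" and "0 < \<alpha>"
    and I: "\<And>j. Ch j \<subseteq> I" "\<And>j. j \<in> I \<Longrightarrow> Ch j = {}"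
  shows "admissible (candidate I X \<alpha>)"
proof -
  have nonneg: "0 \<le> candidate I X \<alpha> v" if "v < n" for v
    using assms that a_nonneg by (simp add: candidate_def)
  moreover have "sum (candidate I X \<alpha>) (Ch j) \<le> candidate I X \<alpha> j" if "j < n" for j
  proof (cases "j \<in> I")
    case False
    have "sum (candidate I X \<alpha>) (Ch j) = (\<Sum>u\<in>Ch j. max 0 (\<alpha> * a u - X u) / \<alpha>)"
      using I(1)[of j] assms(3) by (intro sum.cong) (auto simp: candidate_def max_def field_simps)
    also have "\<dots> = excess X \<alpha> j / \<alpha>"
      by (simp add: excess_def sum_divide_distrib)
    also have "\<dots> \<le> (\<alpha> * a j + X j) / \<alpha>"
      using assms that by (simp add: feasible_def divide_right_mono)
    also have "\<dots> = candidate I X \<alpha> j"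
      using False assms(3) by (simp add: candidate_def field_simps)
    finally show ?thesis .
  qed (use I(2) nonneg that in simp)
  ultimately show ?thesis
    by (simp add: admissible_def)
qed

lemma candidate_cost:
  assumes "nonneg X" and "0 < \<alpha>"
  shows "cost (candidate I X \<alpha>) \<le> total X / \<alpha>"
  unfolding cost_def sum_divide_distrib
proof (rule sum_mono)
  fix v assume "v \<in> {..<n}"
  then have "0 \<le> a v" and "0 \<le> X v / \<alpha>"
    using assms a_nonneg by auto
  then show "\<bar>candidate I X \<alpha> v - a v\<bar> \<le> X v / \<alpha>"
    by (auto simp: candidate_def)
qed

end

section \<open>Reasoning about programs and their running time\<close>

primrec nmod :: "com \<Rightarrow> nat set" where
  "nmod Skip = {}"
| "nmod (NWrite k i e) = {k}"
| "nmod (RWrite k i e) = {}"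
| "nmod (Seq p q) = nmod p \<union> nmod q"
| "nmod (Cond b p q) = nmod p \<union> nmod q"
| "nmod (While b p) = nmod p"

primrec rmod :: "com \<Rightarrow> nat set" where
  "rmod Skip = {}"
| "rmod (NWrite k i e) = {}"
| "rmod (RWrite k i e) = {k}"
| "rmod (Seq p q) = rmod p \<union> rmod q"
| "rmod (Cond b p q) = rmod p \<union> rmod q"
| "rmod (While b p) = rmod p"

definition frame :: "com \<Rightarrow> mem \<Rightarrow> mem \<Rightarrow> bool" where
  "frame p s s' \<longleftrightarrow>
     (\<forall>k. k \<notin> nmod p \<longrightarrow> nats s' k = nats s k) \<and> (\<forall>k. k \<notin> rmod p \<longrightarrow> reals s' k = reals s k)"

lemma exec_frame: "exec p s t s' \<Longrightarrow> frame p s s'"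
  by (induction rule: exec.induct) (auto simp: frame_def nwrite_def rwrite_def)

section \<open>Rules for termination within a time bound\<close>

text \<open>A total-correctness triple with a time budget, stated for one initial memory so that
  postconditions may refer to it.\<close>

definition runs :: "com \<Rightarrow> mem \<Rightarrow> nat \<Rightarrow> (mem \<Rightarrow> bool) \<Rightarrow> bool" where
  "runs p s c Q \<longleftrightarrow> (\<exists>t s'. exec p s t s' \<and> t \<le> c \<and> Q s')"

primrec loop_free :: "com \<Rightarrow> bool" where
  "loop_free Skip \<longleftrightarrow> True"
| "loop_free (NWrite k i e) \<longleftrightarrow> True"
| "loop_free (RWrite k i e) \<longleftrightarrow> True"
| "loop_free (Seq p q) \<longleftrightarrow> loop_free p \<and> loop_free q"
| "loop_free (Cond b p q) \<longleftrightarrow> loop_free p \<and> loop_free q"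
| "loop_free (While b p) \<longleftrightarrow> False"

text \<open>The value at \<open>While\<close> is a dummy: \<open>sem\<close> is related to
  \<open>exec\<close> for loop-free programs only.\<close>

primrec sem :: "com \<Rightarrow> mem \<Rightarrow> mem" where
  "sem Skip s = s"
| "sem (NWrite k i e) s = nwrite k (nval s i) (nval s e) s"
| "sem (RWrite k i e) s = rwrite k (nval s i) (rval s e) s"
| "sem (Seq p q) s = sem q (sem p s)"
| "sem (Cond b p q) s = (if bval s b then sem p s else sem q s)"
| "sem (While b p) s = s"

text \<open>Both branches of a conditional are charged, which keeps the bound independent of the
  memory.\<close>

primrec time_bound :: "com \<Rightarrow> nat" where
  "time_bound Skip = 1"
| "time_bound (NWrite k i e) = 1 + ncost i + ncost e"
| "time_bound (RWrite k i e) = 1 + ncost i + rcost e"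
| "time_bound (Seq p q) = time_bound p + time_bound q"
| "time_bound (Cond b p q) = 1 + bcost b + time_bound p + time_bound q"
| "time_bound (While b p) = 0"

lemma exec_loop_free: "loop_free p \<Longrightarrow> \<exists>t \<le> time_bound p. exec p s t (sem p s)"
proof (induction p arbitrary: s)
  case (Seq p q)
  then obtain t u where "t \<le> time_bound p" "exec p s t (sem p s)"
      "u \<le> time_bound q" "exec q (sem p s) u (sem q (sem p s))"
    by fastforce
  then show ?case
    using exec.Seq by (intro exI[of _ "t + u"]) auto
next
  case (Cond b p q)
  then obtain t u where tu: "t \<le> time_bound p" "exec p s t (sem p s)"
      "u \<le> time_bound q" "exec q s u (sem q s)"
    by fastforce
  show ?case
  proof (cases "bval s b")
    case True
    then show ?thesis
      using tu exec.CondTrue[OF True tu(2)] by (intro exI[of _ "1 + bcost b + t"]) auto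
  next
    case False
    then show ?thesis
      using tu exec.CondFalse[OF False tu(4)] by (intro exI[of _ "1 + bcost b + u"]) auto
  qed
qed (use exec.Skip exec.NWrite exec.RWrite in fastforce)+

lemma runs_loop_free:
  assumes "loop_free p" and "time_bound p \<le> c" and "Q (sem p s)"
  shows "runs p s c Q"
  using exec_loop_free[OF assms(1), of s] assms order_trans unfolding runs_def by blast

text \<open>The frame of \<open>p\<close> is passed on to \<open>q\<close>, so \<open>P\<close> has
  to mention only what \<open>p\<close> changes.\<close>

lemma runs_Seq:
  assumes "runs p s c P" and "\<And>s'. P s' \<Longrightarrow> frame p s s' \<Longrightarrow> runs q s' d Q" and "c + d \<le> e"
  shows "runs (Seq p q) s e Q"
proof -
  obtain t s' where p: "exec p s t s'" "t \<le> c" "P s'"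
    using assms(1) by (auto simp: runs_def)
  then obtain u s'' where q: "exec q s' u s''" "u \<le> d" "Q s''"
    using assms(2)[OF p(3) exec_frame[OF p(1)]] by (auto simp: runs_def)
  then show ?thesis
    using p assms(3) exec.Seq[OF p(1) q(1)] unfolding runs_def by (auto intro!: exI)
qed

lemma runs_Cond:
  assumes "bval s b \<Longrightarrow> runs p s c Q" and "\<not> bval s b \<Longrightarrow> runs q s c Q" and "1 + bcost b + c \<le> d"
  shows "runs (Cond b p q) s d Q"
proof (cases "bval s b")
  case True
  then obtain t s' where "exec p s t s'" "t \<le> c" "Q s'"
    using assms(1) by (auto simp: runs_def)
  then show ?thesis
    using True assms(3) exec.CondTrue[of s b p t s' q] unfolding runs_def by (auto intro!: exI)
next
  case False
  then obtain t s' where "exec q s t s'" "t \<le> c" "Q s'"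
    using assms(2) by (auto simp: runs_def)
  then show ?thesis
    using False assms(3) exec.CondFalse[of s b q t s' p] unfolding runs_def by (auto intro!: exI)
qed

lemma runs_mono: "runs p s c Q \<Longrightarrow> (\<And>s'. Q s' \<Longrightarrow> frame p s s' \<Longrightarrow> R s') \<Longrightarrow> c \<le> d \<Longrightarrow> runs p s d R"
  unfolding runs_def using exec_frame order_trans by metis

lemma frame_refl: "frame p s s"
  by (simp add: frame_def)

lemma frame_trans: "frame p s s' \<Longrightarrow> frame p s' s'' \<Longrightarrow> frame p s s''"
  by (simp add: frame_def)

text \<open>The number \<open>N\<close> of rounds is fixed in advance and the invariant is indexed
  by the round. Induction on the remaining rounds then yields termination and the cost of
  \<open>N\<close> bodies and \<open>N + 1\<close> tests together.\<close>

lemma runs_While: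
  assumes "I 0 s"
    and step: "\<And>i s'. i < N \<Longrightarrow> I i s' \<Longrightarrow> frame p s s' \<Longrightarrow> bval s' b \<and> runs p s' c (I (Suc i))"
    and exit: "\<And>s'. I N s' \<Longrightarrow> frame p s s' \<Longrightarrow> \<not> bval s' b \<and> Q s'"
    and "N * (c + 1 + bcost b) + 1 + bcost b \<le> d"
  shows "runs (While b p) s d Q"
proof -
  have "runs (While b p) s' ((N - i) * (c + 1 + bcost b) + 1 + bcost b) Q"
    if "i \<le> N" "I i s'" "frame p s s'" for i s'
    using that
  proof (induction "N - i" arbitrary: i s')
    case 0
    then have "\<not> bval s' b \<and> Q s'"
      using exit by simp
    then show ?case
      using exec.WhileFalse[of s' b p] 0 by (auto simp: runs_def intro!: exI)
  next
    case (Suc k)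
    have body: "bval s' b" "runs p s' c (I (Suc i))"
      using step[of i s'] Suc by auto
    then obtain t s2 where t: "exec p s' t s2" "t \<le> c" "I (Suc i) s2"
      by (auto simp: runs_def)
    moreover have "frame p s s2"
      using frame_trans[OF Suc.prems(3) exec_frame[OF t(1)]] .
    ultimately have "runs (While b p) s2 ((N - Suc i) * (c + 1 + bcost b) + 1 + bcost b) Q"
      using Suc by simp
    then obtain u s3 where u: "exec (While b p) s2 u s3" "Q s3"
        "u \<le> (N - Suc i) * (c + 1 + bcost b) + 1 + bcost b"
      by (auto simp: runs_def)
    have "N - i = Suc (N - Suc i)"
      using Suc.hyps(2) by simp
    then have "1 + bcost b + t + u \<le> (N - i) * (c + 1 + bcost b) + 1 + bcost b"
      using u(3) t(2) by simp
    then show ?case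
      using exec.WhileTrue[OF body(1) t(1) u(1)] u(2) unfolding runs_def by blast
  qed
  from this[of 0 s] show ?thesis
    using assms(1,4) frame_refl unfolding runs_def by (fastforce intro: order_trans)
qed

abbreviation (input) nvar :: "nat \<Rightarrow> nexp" where
  "nvar k \<equiv> NRead k (NConst 0)"

abbreviation (input) rvar :: "nat \<Rightarrow> rexp" where
  "rvar k \<equiv> RRead k (NConst 0)"

abbreviation (input) nset :: "nat \<Rightarrow> nexp \<Rightarrow> com" where
  "nset k e \<equiv> NWrite k (NConst 0) e"

abbreviation (input) rset :: "nat \<Rightarrow> rexp \<Rightarrow> com" where
  "rset k e \<equiv> RWrite k (NConst 0) e"

text \<open>The bound is read from the input: cell 0 of array 0 holds the number of vertices, cell 1
  the number of edges.\<close>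

definition for_loop :: "nat \<Rightarrow> nat \<Rightarrow> com \<Rightarrow> com" where
  "for_loop k c p = Seq (nset k (NConst 0))
     (While (NLess (nvar k) (NRead 0 (NConst c))) (Seq p (nset k (NPlus (nvar k) (NConst 1)))))"

lemma mod_for_loop [simp]:
  "nmod (for_loop k c p) = insert k (nmod p)" "rmod (for_loop k c p) = rmod p"
  by (auto simp: for_loop_def)

text \<open>The invariant is re-established for the memory in which the counter is already raised.
  The 12 per round pays for test and increment, the final 12 for initialisation and last
  test.\<close>

lemma runs_for_loop:
  assumes "k \<notin> nmod p" "0 \<notin> nmod p" "k \<noteq> 0" and N: "N = nats s 0 c"
    and init: "I 0 (nwrite k 0 0 s)"
    and step: "\<And>i s'. i < N \<Longrightarrow> I i s' \<Longrightarrow> nats s' k 0 = i \<Longrightarrow> frame (for_loop k c p) s s' \<Longrightarrow>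
      runs p s' d (\<lambda>s''. I (Suc i) (nwrite k 0 (Suc i) s''))"
    and exit: "\<And>s'. I N s' \<Longrightarrow> frame (for_loop k c p) s s' \<Longrightarrow> Q s'"
    and time: "N * (d + 12) + 12 \<le> e"
  shows "runs (for_loop k c p) s e Q"
  unfolding for_loop_def
proof (rule runs_Seq[where c = 3 and P = "\<lambda>s'. s' = nwrite k 0 0 s" and d = "N * (d + 12) + 6"])
  let ?body = "Seq p (nset k (NPlus (nvar k) (NConst 1)))"
  fix s1 assume s1: "s1 = nwrite k 0 0 s"
  let ?J = "\<lambda>i s'. I i s' \<and> nats s' k 0 = i"
  have frame: "frame (for_loop k c p) s s'" if "frame ?body s1 s'" for s'
    using that by (auto simp: frame_def s1 nwrite_def)
  have N': "nats s' 0 c = N" if "frame ?body s1 s'" for s'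
    using that assms(2,3) by (auto simp: frame_def s1 nwrite_def N)
  show "runs (While (NLess (nvar k) (NRead 0 (NConst c))) ?body) s1 (N * (d + 12) + 6) Q"
  proof (rule runs_While[where I = ?J and N = N and c = "d + 6"])
    show "?J 0 s1"
      using init by (simp add: s1 nwrite_def)
  next
    fix i s' assume *: "i < N" "?J i s'" "frame ?body s1 s'"
    have "runs ?body s' (d + 6) (?J (Suc i))"
    proof (rule runs_Seq[where c = d and d = 6])
      show "runs p s' d (\<lambda>s''. I (Suc i) (nwrite k 0 (Suc i) s''))"
        using step * frame by blast
      fix s'' assume I: "I (Suc i) (nwrite k 0 (Suc i) s'')" and "frame p s' s''"
      then have "nats s'' k 0 = i"
        using * assms(1) by (auto simp: frame_def)
      then show "runs (nset k (NPlus (nvar k) (NConst 1))) s'' 6 (?J (Suc i))"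
        using I by (intro runs_loop_free) (auto simp: nwrite_def)
    qed simp
    then show "bval s' (NLess (nvar k) (NRead 0 (NConst c))) \<and> runs ?body s' (d + 6) (?J (Suc i))"
      using * N' by simp
  qed (use exit frame N' in auto)
qed (use time in \<open>auto intro!: runs_loop_free\<close>)

definition nat_eq :: "nexp \<Rightarrow> nexp \<Rightarrow> bexp" where
  "nat_eq e f = BAnd (BNot (NLess e f)) (BNot (NLess f e))"

lemma bval_nat_eq [simp]: "bval s (nat_eq e f) \<longleftrightarrow> nval s e = nval s f"
  by (auto simp: nat_eq_def)

lemma bcost_nat_eq [simp]: "bcost (nat_eq e f) = 5 + 2 * ncost e + 2 * ncost f"
  by (simp add: nat_eq_def)

section \<open>The program\<close>

text \<open>
  Besides the input, the program uses these arrays; all but the vectors 2 and 3 are scalars in cell 0.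
  Naturals: 4 is the current vertex \<open>j\<close>, 5 the current edge, 6 a power of two.
  Reals: 2 is the best candidate so far and 8 its cost bound, 3 the weights \<open>X\<close>, 4 the scale
  \<open>\<alpha>\<close>, 5 the excess of \<open>j\<close>, 6 the maximal excess, 7 the total weight, 9 the factor \<open>b\<close>,
  10 the rounded-up binary logarithm of the number of vertices, 11 the phase counter, 12 is \<open>b - 1\<close>.
\<close>

definition slack :: rexp where
  "slack = RMinus (RTimes (rvar 4) (RRead 1 (NRead 2 (nvar 5)))) (RRead 3 (NRead 2 (nvar 5)))"

text \<open>True when the current edge leads from an active child into the current vertex.\<close>

definition at_edge :: bexp where
  "at_edge = BAnd (nat_eq (NRead 3 (nvar 5)) (nvar 4)) (RLess (RConst 0) slack)"

definition scan_com :: com where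
  "scan_com = Seq (rset 5 (RConst 0))
     (for_loop 5 1 (Cond at_edge (rset 5 (RPlus (rvar 5) slack)) Skip))"

definition scale_com :: "nexp \<Rightarrow> com" where
  "scale_com i = RWrite 3 i (RTimes (rvar 9) (RRead 3 i))"

definition update_com :: com where
  "update_com = Seq (for_loop 5 1 (Cond at_edge (scale_com (NRead 2 (nvar 5))) Skip))
     (scale_com (nvar 4))"

definition row_com :: com where
  "row_com = Seq scan_com
     (Cond (RLess (RPlus (RTimes (rvar 4) (RRead 1 (nvar 4))) (RRead 3 (nvar 4))) (rvar 5))
        update_com Skip)"

definition max_excess_com :: com where
  "max_excess_com = for_loop 4 0 (Seq scan_com
     (Cond (RLess (rvar 6) (RMinus (rvar 5) (RRead 1 (nvar 4))))
        (rset 6 (RMinus (rvar 5) (RRead 1 (nvar 4)))) Skip))"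

text \<open>The initial cost bound exceeds the total weight by 1, so the first phase certainly
  stores a candidate.\<close>

definition start_com :: com where
  "start_com = Seq (rset 8 (RConst 1))
     (for_loop 4 0 (Seq (RWrite 3 (nvar 4) (rvar 6)) (rset 8 (RPlus (rvar 8) (rvar 6)))))"

definition candidate_com :: com where
  "candidate_com = for_loop 4 0
     (Cond (NLess (NConst 0) (NRead 1 (nvar 4)))
        (Cond (RLess (RRead 1 (nvar 4)) (RDivide (RRead 3 (nvar 4)) (rvar 4)))
           (RWrite 2 (nvar 4) (RConst 0))
           (RWrite 2 (nvar 4) (RMinus (RRead 1 (nvar 4)) (RDivide (RRead 3 (nvar 4)) (rvar 4)))))
        (RWrite 2 (nvar 4) (RPlus (RRead 1 (nvar 4)) (RDivide (RRead 3 (nvar 4)) (rvar 4)))))"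

definition save_com :: com where
  "save_com = Seq (rset 7 (RConst 0))
     (Seq (for_loop 4 0 (rset 7 (RPlus (rvar 7) (RRead 3 (nvar 4)))))
       (Cond (RLess (rvar 7) (RTimes (rvar 8) (rvar 4)))
         (Seq (rset 8 (RDivide (rvar 7) (rvar 4))) candidate_com) Skip))"

text \<open>The exponent is counted as a real beside the doubled natural, since expressions offer no
  passage from naturals to reals.\<close>

definition log_com :: com where
  "log_com = Seq (nset 6 (NConst 1)) (Seq (rset 10 (RConst 0))
     (While (NLess (nvar 6) (NRead 0 (NConst 0)))
       (Seq (nset 6 (NPlus (nvar 6) (nvar 6))) (rset 10 (RPlus (rvar 10) (RConst 1))))))"

definition phase_com :: com where
  "phase_com = Seq save_com (Seq (rset 4 (RTimes (rvar 4) (rvar 9)))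
     (Seq (for_loop 4 0 row_com) (rset 11 (RPlus (rvar 11) (RConst 1)))))"

text \<open>The loop ends at the first \<open>t\<close> with
  \<open>t * (b - 1)^2 \<ge> 2 * l\<close>, the number of phases required by
  \<open>approximation\<close>.\<close>

definition phases_com :: com where
  "phases_com = Seq (rset 11 (RConst 0))
     (While (RLess (RTimes (rvar 11) (RTimes (rvar 12) (rvar 12))) (RTimes (RConst 2) (rvar 10)))
       phase_com)"

text \<open>Sets \<open>b - 1\<close> to \<open>min 1 \<epsilon> / 6\<close>, so that
  \<open>b \<le> 7 / 6\<close> and the ratio \<open>1 + 6 * (b - 1)\<close> is at most
  \<open>1 + \<epsilon>\<close>.\<close>

definition setup_com :: com where
  "setup_com = Seq
     (Cond (RLess (rvar 0) (RConst 1)) (rset 12 (RDivide (rvar 0) (RConst 6)))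
       (rset 12 (RConst (1 / 6))))
     (Seq (rset 9 (RPlus (RConst 1) (rvar 12))) (rset 4 (RConst 1)))"

definition solve_com :: com where
  "solve_com = Seq setup_com (Seq max_excess_com (Seq start_com (Seq log_com phases_com)))"

definition copy_com :: com where
  "copy_com = for_loop 4 0 (RWrite 2 (nvar 4) (RRead 1 (nvar 4)))"

definition algorithm :: com where
  "algorithm = Cond (NLess (NConst 0) (NRead 0 (NConst 1))) solve_com copy_com"

lemmas com_defs = scan_com_def update_com_def scale_com_def row_com_def max_excess_com_def
  start_com_def candidate_com_def save_com_def log_com_def phase_com_def phases_com_def
  setup_com_def

section \<open>Correctness and running time of the program\<close>

locale loaded =
  fixes n m :: nat and src dst part :: "nat \<Rightarrow> nat" and a :: "nat \<Rightarrow> real" and b :: real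
  assumes src_less: "k < m \<Longrightarrow> src k < n"
    and dst_less: "k < m \<Longrightarrow> dst k < n"
    and part_src: "k < m \<Longrightarrow> part (src k) = 1"
    and part_dst: "k < m \<Longrightarrow> part (dst k) = 0"
    and edge_inj: "k < m \<Longrightarrow> l < m \<Longrightarrow> src k = src l \<Longrightarrow> dst k = dst l \<Longrightarrow> k = l"
    and a_nonneg': "i < n \<Longrightarrow> 0 \<le> a i"
    and b_gt_1': "1 < b"
    and m_pos: "0 < m"
begin

definition Ch :: "nat \<Rightarrow> nat set" where
  "Ch j = src ` {k. k < m \<and> dst k = j}"

lemma src_neq_dst: "k < m \<Longrightarrow> l < m \<Longrightarrow> dst l \<noteq> src k"
  using part_src part_dst by (metis zero_neq_one)

sublocale cover n Ch a b
  by unfold_locales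
    (use src_less src_neq_dst a_nonneg' b_gt_1' in \<open>auto simp: Ch_def\<close>)

text \<open>Since no edge is repeated, a scan of the edge list meets each child of \<open>j\<close>
  exactly once.\<close>

lemma sum_Ch: "(\<Sum>k<m. if dst k = j then f (src k) else 0) = sum f (Ch j)"
proof -
  have "inj_on src {k. k < m \<and> dst k = j}"
    using edge_inj by (auto simp: inj_on_def)
  then have "sum f (Ch j) = (\<Sum>k | k < m \<and> dst k = j. f (src k))"
    unfolding Ch_def by (simp add: sum.reindex)
  also have "\<dots> = (\<Sum>k | k \<in> {..<m} \<and> dst k = j. f (src k))"
    by simp
  also have "\<dots> = (\<Sum>k<m. if dst k = j then f (src k) else 0)"
    by (rule sum.inter_filter) simp
  finally show ?thesis ..
qed

text \<open>These input cells are never written by the program, so \<open>base\<close> passes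
  through every frame.\<close>

definition base :: "mem \<Rightarrow> bool" where
  "base s \<longleftrightarrow> nats s 0 0 = n \<and> nats s 0 1 = m \<and> nats s 1 = part \<and> nats s 2 = src \<and> nats s 3 = dst \<and>
     reals s 1 = a"

section \<open>Scanning and updating one row\<close>

lemma scan_spec:
  assumes s: "base s"
  shows "runs scan_com s (100 * m) (\<lambda>s'. reals s' 5 0 = excess (reals s 3) (reals s 4 0) (nats s 4 0))"
  unfolding scan_com_def
proof (rule runs_Seq[where c = 3 and d = "m * 72 + 12" and P = "\<lambda>s'. reals s' 5 0 = 0"])
  let ?X = "reals s 3" and ?\<alpha> = "reals s 4 0" and ?j = "nats s 4 0"
  let ?f = "\<lambda>k. if dst k = ?j then max 0 (?\<alpha> * a (src k) - ?X (src k)) else 0"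
  fix s1 assume q: "reals s1 5 0 = 0" and fr: "frame (rset 5 (RConst 0)) s s1"
  show "runs (for_loop 5 1 (Cond at_edge (rset 5 (RPlus (rvar 5) slack)) Skip)) s1 (m * 72 + 12)
    (\<lambda>s'. reals s' 5 0 = excess ?X ?\<alpha> ?j)"
  proof (rule runs_for_loop[where I = "\<lambda>i s'. reals s' 5 0 = (\<Sum>k<i. ?f k)" and N = m and d = 60])
    fix i s'
    assume *: "i < m" "reals s' 5 0 = (\<Sum>k<i. ?f k)" "nats s' 5 0 = i"
      "frame (for_loop 5 1 (Cond at_edge (rset 5 (RPlus (rvar 5) slack)) Skip)) s1 s'"
    show "runs (Cond at_edge (rset 5 (RPlus (rvar 5) slack)) Skip) s' 60
      (\<lambda>s''. reals (nwrite 5 0 (Suc i) s'') 5 0 = (\<Sum>k<Suc i. ?f k))"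
      by (rule runs_loop_free)
        (use s fr * in \<open>auto simp: at_edge_def slack_def frame_def base_def nwrite_def rwrite_def\<close>)
  next
    fix s' assume "reals s' 5 0 = (\<Sum>k<m. ?f k)"
    then show "reals s' 5 0 = excess ?X ?\<alpha> ?j"
      unfolding excess_def sum_Ch[of _ "\<lambda>u. max 0 (?\<alpha> * a u - ?X u)", symmetric] .
  qed (use s fr q in \<open>auto simp: frame_def base_def nwrite_def\<close>)
qed (use m_pos in \<open>auto intro!: runs_loop_free simp: rwrite_def\<close>)

lemma update_spec:
  assumes s: "base s" and j: "nats s 4 0 = j" and X: "reals s 3 = X" "reals s 4 0 = \<alpha>"
    "reals s 9 0 = b"
  shows "runs update_com s (100 * m) (\<lambda>s'. reals s' 3 =
    (\<lambda>v. if v = j \<or> v \<in> active X \<alpha> j then b * X v else X v))"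
  unfolding update_com_def
proof (rule runs_Seq)
  let ?body = "Cond at_edge (scale_com (NRead 2 (nvar 5))) Skip"
  let ?Y = "\<lambda>i v. if (\<exists>k<i. src k = v \<and> dst k = j) \<and> X v < \<alpha> * a v then b * X v else X v"
  show "runs (for_loop 5 1 ?body) s (m * 72 + 12) (\<lambda>s'. reals s' 3 = ?Y m)"
  proof (rule runs_for_loop[where I = "\<lambda>i s'. reals s' 3 = ?Y i" and N = m and d = 60])
    fix i s'
    assume *: "i < m" "reals s' 3 = ?Y i" "nats s' 5 0 = i" "frame (for_loop 5 1 ?body) s s'"
    \<comment> \<open>As no edge is repeated, the weight tested and scaled at edge \<open>i\<close>
      still has its original value.\<close>
    have new: "\<not> (\<exists>k<i. src k = src i \<and> dst k = j)" if "dst i = j"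
      using edge_inj[of _ i] that *(1) by (metis less_irrefl less_trans)
    have "reals (sem ?body s') 3 = ?Y (Suc i)"
    proof (cases "dst i = j \<and> X (src i) < \<alpha> * a (src i)")
      case True
      then have "reals (sem ?body s') 3 = (?Y i)(src i := b * X (src i))"
        using s j X * new
        by (auto simp: at_edge_def slack_def scale_com_def frame_def base_def rwrite_def)
      also have "\<dots> = ?Y (Suc i)"
        using True by (auto simp: fun_eq_iff less_Suc_eq)
      finally show ?thesis .
    next
      case False
      then have "reals (sem ?body s') 3 = ?Y i"
        using s j X * new
        by (auto simp: at_edge_def slack_def scale_com_def frame_def base_def rwrite_def)
      also have "\<dots> = ?Y (Suc i)"
        using False by (auto simp: fun_eq_iff less_Suc_eq)
      finally show ?thesis .
    qed
    then show "runs ?body s' 60 (\<lambda>s''. reals (nwrite 5 0 (Suc i) s'') 3 = ?Y (Suc i))"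
      by (intro runs_loop_free)
        (auto simp: at_edge_def slack_def scale_com_def nwrite_def)
  qed (use s X in \<open>auto simp: base_def nwrite_def scale_com_def\<close>)
  fix s' assume Y: "reals s' 3 = ?Y m" and fr: "frame (for_loop 5 1 ?body) s s'"
  have act: "v \<in> active X \<alpha> j \<longleftrightarrow> (\<exists>k<m. src k = v \<and> dst k = j) \<and> X v < \<alpha> * a v" for v
    by (auto simp: active_def Ch_def)
  \<comment> \<open>The vertex \<open>j\<close> is not its own child, so its weight is untouched
    until it is scaled last.\<close>
  have "j \<notin> active X \<alpha> j"
    using Ch_irrefl by (simp add: active_def)
  then have "?Y m j = X j"
    unfolding act by auto
  moreover have "nats s' 4 0 = j" "reals s' 9 0 = b"
    using fr j X(3) by (auto simp: frame_def scale_com_def)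
  ultimately have "reals (sem (scale_com (nvar 4)) s') 3 = (?Y m)(j := b * X j)"
    using Y by (simp add: scale_com_def rwrite_def)
  also have "\<dots> = (\<lambda>v. if v = j \<or> v \<in> active X \<alpha> j then b * X v else X v)"
    by (auto simp: fun_eq_iff act)
  finally have "reals (sem (scale_com (nvar 4)) s') 3
      = (\<lambda>v. if v = j \<or> v \<in> active X \<alpha> j then b * X v else X v)" .
  then show "runs (scale_com (nvar 4)) s' 10
      (\<lambda>s'. reals s' 3 = (\<lambda>v. if v = j \<or> v \<in> active X \<alpha> j then b * X v else X v))"
    by (intro runs_loop_free) (auto simp: scale_com_def)
qed (use m_pos in simp)

lemma row_spec:
  assumes s: "base s" and "reals s 9 0 = b"
  shows "runs row_com s (300 * m) (\<lambda>s'. reals s' 3 = row (reals s 3) (reals s 4 0) (nats s 4 0))"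
  unfolding row_com_def
proof (rule runs_Seq[OF scan_spec[OF s]])
  fix s' assume q: "reals s' 5 0 = excess (reals s 3) (reals s 4 0) (nats s 4 0)"
    and fr: "frame scan_com s s'"
  have s': "base s'" "nats s' 4 = nats s 4" "reals s' 3 = reals s 3" "reals s' 4 = reals s 4"
      "reals s' 9 = reals s 9"
    using s fr by (auto simp: frame_def base_def com_defs)
  let ?b = "RLess (RPlus (RTimes (rvar 4) (RRead 1 (nvar 4))) (RRead 3 (nvar 4))) (rvar 5)"
  show "runs (Cond ?b update_com Skip) s' (200 * m)
    (\<lambda>s'. reals s' 3 = row (reals s 3) (reals s 4 0) (nats s 4 0))"
  proof (rule runs_Cond[where c = "100 * m"])
    assume "bval s' ?b"
    then show "runs update_com s' (100 * m)
        (\<lambda>s'. reals s' 3 = row (reals s 3) (reals s 4 0) (nats s 4 0))"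
      using s' q assms
      by (intro runs_mono[OF update_spec[OF s'(1) refl refl refl]]) (auto simp: row_def base_def)
  next
    assume "\<not> bval s' ?b"
    then show "runs Skip s' (100 * m)
        (\<lambda>s'. reals s' 3 = row (reals s 3) (reals s 4 0) (nats s 4 0))"
      using s' q m_pos by (intro runs_loop_free) (auto simp: row_def base_def)
  qed (use m_pos in simp)
qed simp

section \<open>Sweeps and initial weights in the program\<close>

lemma n_pos: "0 < n"
  using src_less[OF m_pos] by simp

lemma n_le: "n \<le> n * m" "1 \<le> n * m"
  using n_pos m_pos by simp_all

lemma rows_spec:
  assumes s: "base s" and "reals s 9 0 = b"
  shows "runs (for_loop 4 0 row_com) s (330 * (n * m))
    (\<lambda>s'. reals s' 3 = rows (reals s 3) (reals s 4 0) n)"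
proof (rule runs_for_loop[where N = n and d = "300 * m"
      and I = "\<lambda>i s'. reals s' 3 = rows (reals s 3) (reals s 4 0) i"])
  fix i s'
  assume *: "i < n" "reals s' 3 = rows (reals s 3) (reals s 4 0) i" "nats s' 4 0 = i"
    "frame (for_loop 4 0 row_com) s s'"
  then have "base s'" "reals s' 9 0 = b" "reals s' 4 = reals s 4"
    using assms by (auto simp: frame_def base_def com_defs)
  then show "runs row_com s' (300 * m)
      (\<lambda>s''. reals (nwrite 4 0 (Suc i) s'') 3 = rows (reals s 3) (reals s 4 0) (Suc i))"
    using * by (intro runs_mono[OF row_spec]) (auto simp: nwrite_def)
next
  show "n * (300 * m + 12) + 12 \<le> 330 * (n * m)"
    using n_pos m_pos by (cases n; cases m) (simp_all add: algebra_simps)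
qed (use s in \<open>auto simp: com_defs base_def nwrite_def\<close>)

lemma max_excess_spec:
  assumes s: "base s" and "reals s 3 = (\<lambda>_. 0)" "reals s 4 0 = 1" "reals s 6 0 = 0"
  shows "runs max_excess_com s (200 * (n * m)) (\<lambda>s'. reals s' 6 0 = max_excess n)"
  unfolding max_excess_com_def
proof (rule runs_for_loop[where N = n and d = "100 * m + 50"
      and I = "\<lambda>i s'. reals s' 6 0 = max_excess i"])
  let ?upd = "Cond (RLess (rvar 6) (RMinus (rvar 5) (RRead 1 (nvar 4))))
        (rset 6 (RMinus (rvar 5) (RRead 1 (nvar 4)))) Skip"
  fix i s'
  assume *: "i < n" "reals s' 6 0 = max_excess i" "nats s' 4 0 = i"
    "frame (for_loop 4 0 (Seq scan_com ?upd)) s s'"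
  then have s': "base s'" "reals s' 3 = (\<lambda>_. 0)" "reals s' 4 0 = 1"
    using assms by (auto simp: frame_def base_def com_defs)
  show "runs (Seq scan_com ?upd) s' (100 * m + 50)
      (\<lambda>s''. reals (nwrite 4 0 (Suc i) s'') 6 0 = max_excess (Suc i))"
  proof (rule runs_Seq[OF scan_spec[OF s'(1)]])
    fix s'' assume "reals s'' 5 0 = excess (reals s' 3) (reals s' 4 0) (nats s' 4 0)"
      "frame scan_com s' s''"
    then show "runs ?upd s'' 50 (\<lambda>s''. reals (nwrite 4 0 (Suc i) s'') 6 0 = max_excess (Suc i))"
      using s' * by (intro runs_loop_free)
        (auto simp: frame_def base_def com_defs nwrite_def rwrite_def max_excess_simps max_def)
  qed simp
next
  show "n * (100 * m + 50 + 12) + 12 \<le> 200 * (n * m)"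
    using n_pos m_pos by (cases n; cases m) (simp_all add: algebra_simps)
qed (use assms in \<open>auto simp: com_defs base_def nwrite_def max_excess_simps\<close>)

lemma start_spec:
  assumes s: "base s" and "reals s 3 = (\<lambda>_. 0)" "reals s 6 0 = max_excess n"
  shows "runs start_com s (60 * (n * m))
    (\<lambda>s'. reals s' 3 = start \<and> reals s' 8 0 = 1 + total start)"
  unfolding start_com_def
proof (rule runs_Seq[where c = 10 and d = "n * 32 + 12" and P = "\<lambda>s'. reals s' 8 0 = 1"])
  let ?body = "Seq (RWrite 3 (nvar 4) (rvar 6)) (rset 8 (RPlus (rvar 8) (rvar 6)))"
  let ?I = "\<lambda>i s'. reals s' 3 = (\<lambda>v. if v < i then max_excess n else 0) \<and>
    reals s' 8 0 = 1 + real i * max_excess n"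
  fix s1 assume s1: "reals s1 8 0 = 1" "frame (rset 8 (RConst 1)) s s1"
  show "runs (for_loop 4 0 ?body) s1 (n * 32 + 12)
    (\<lambda>s'. reals s' 3 = start \<and> reals s' 8 0 = 1 + total start)"
  proof (rule runs_for_loop[where N = n and d = 20 and I = ?I])
    fix i s'
    assume "i < n" "?I i s'" "nats s' 4 0 = i" "frame (for_loop 4 0 ?body) s1 s'"
    then show "runs ?body s' 20 (\<lambda>s''. ?I (Suc i) (nwrite 4 0 (Suc i) s''))"
      using s1 assms by (intro runs_loop_free)
        (auto simp: frame_def nwrite_def rwrite_def fun_eq_iff algebra_simps)
  qed (use s1 assms in \<open>auto simp: frame_def base_def nwrite_def start_def fun_eq_iff\<close>)
next
  show "10 + (n * 32 + 12) \<le> 60 * (n * m)"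
    using n_pos m_pos by (cases n; cases m) simp_all
qed (auto intro!: runs_loop_free simp: rwrite_def)

section \<open>Storing candidates and computing the logarithm\<close>

lemma candidate_spec:
  assumes s: "base s"
  shows "runs candidate_com s (n * 62 + 12) (\<lambda>s'. \<forall>v<n. reals s' 2 v =
    candidate {v. 0 < part v} (reals s 3) (reals s 4 0) v)"
  unfolding candidate_com_def
proof (rule runs_for_loop[where N = n and d = 50 and I = "\<lambda>i s'. \<forall>v<i. reals s' 2 v =
    candidate {v. 0 < part v} (reals s 3) (reals s 4 0) v"])
qed (use s in \<open>auto intro!: runs_loop_free
    simp: frame_def base_def nwrite_def rwrite_def candidate_def less_Suc_eq\<close>)

lemma save_spec:
  assumes s: "base s"
  defines "\<alpha> \<equiv> reals s 4 0" and "D \<equiv> total (reals s 3)" and "B \<equiv> reals s 8 0"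
  shows "runs save_com s (140 * (n * m)) (\<lambda>s'.
    if D < B * \<alpha>
    then reals s' 8 0 = D / \<alpha> \<and> (\<forall>v<n. reals s' 2 v = candidate {v. 0 < part v} (reals s 3) \<alpha> v)
    else reals s' 8 0 = B \<and> reals s' 2 = reals s 2)"
  unfolding save_com_def
proof (rule runs_Seq[where c = 3 and P = "\<lambda>s'. reals s' 7 0 = 0" and d = "n * 86 + 50"])
  let ?body = "rset 7 (RPlus (rvar 7) (RRead 3 (nvar 4)))"
  let ?test = "RLess (rvar 7) (RTimes (rvar 8) (rvar 4))"
  let ?store = "Seq (rset 8 (RDivide (rvar 7) (rvar 4))) candidate_com"
  let ?Q = "\<lambda>s'. if D < B * \<alpha>
    then reals s' 8 0 = D / \<alpha> \<and> (\<forall>v<n. reals s' 2 v = candidate {v. 0 < part v} (reals s 3) \<alpha> v)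
    else reals s' 8 0 = B \<and> reals s' 2 = reals s 2"
  fix s1 assume s1: "reals s1 7 0 = 0" "frame (rset 7 (RConst 0)) s s1"
  show "runs (Seq (for_loop 4 0 ?body) (Cond ?test ?store Skip)) s1 (n * 86 + 50) ?Q"
  proof (rule runs_Seq[where P = "\<lambda>s'. reals s' 7 0 = D" and c = "n * 22 + 12" and d = "n * 62 + 38"])
    show "runs (for_loop 4 0 ?body) s1 (n * 22 + 12) (\<lambda>s'. reals s' 7 0 = D)"
    proof (rule runs_for_loop[where N = n and d = 10 and I = "\<lambda>i s'. reals s' 7 0 = (\<Sum>v<i. reals s 3 v)"])
    qed (use s s1 in \<open>auto intro!: runs_loop_free
        simp: frame_def base_def nwrite_def rwrite_def D_def\<close>)
    fix s2 assume s2: "reals s2 7 0 = D" "frame (for_loop 4 0 ?body) s1 s2"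
    have s2': "base s2" "reals s2 3 = reals s 3" "reals s2 4 = reals s 4" "reals s2 8 = reals s 8"
        "reals s2 2 = reals s 2"
      using s s1(2) s2(2) by (auto simp: frame_def base_def)
    show "runs (Cond ?test ?store Skip) s2 (n * 62 + 38) ?Q"
    proof (rule runs_Cond[where c = "n * 62 + 25"])
      assume test: "bval s2 ?test"
      show "runs ?store s2 (n * 62 + 25) ?Q"
      proof (rule runs_Seq[where c = 10 and d = "n * 62 + 12" and P = "\<lambda>s'. reals s' 8 0 = D / \<alpha>"])
        fix s3 assume s3: "reals s3 8 0 = D / \<alpha>" "frame (rset 8 (RDivide (rvar 7) (rvar 4))) s2 s3"
        then have s3': "base s3" "reals s3 3 = reals s 3" "reals s3 4 = reals s 4"
          using s2' by (auto simp: frame_def base_def)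
        show "runs candidate_com s3 (n * 62 + 12) ?Q"
          by (rule runs_mono[OF candidate_spec[OF s3'(1)]])
            (use s3 s3' s2 s2' test in \<open>auto simp: frame_def candidate_com_def \<alpha>_def B_def\<close>)
      qed (use s2 s2' in \<open>auto intro!: runs_loop_free simp: rwrite_def \<alpha>_def\<close>)
    next
      assume "\<not> bval s2 ?test"
      then show "runs Skip s2 (n * 62 + 25) ?Q"
        using s2 s2' by (intro runs_loop_free) (auto simp: \<alpha>_def B_def)
    qed simp
  qed simp
next
  show "3 + (n * 86 + 50) \<le> 140 * (n * m)"
    using n_pos m_pos by (cases n; cases m) simp_all
qed (auto intro!: runs_loop_free simp: rwrite_def)

lemma log_spec:
  assumes s: "base s" and l: "n \<le> 2 ^ l" "\<And>i. i < l \<Longrightarrow> 2 ^ i < n"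
  shows "runs log_com s (30 * l + 20) (\<lambda>s'. reals s' 10 0 = real l)"
  unfolding log_com_def
proof (rule runs_Seq[where c = 5 and P = "\<lambda>s'. nats s' 6 0 = 1" and d = "30 * l + 15"])
  let ?body = "Seq (nset 6 (NPlus (nvar 6) (nvar 6))) (rset 10 (RPlus (rvar 10) (RConst 1)))"
  let ?w = "While (NLess (nvar 6) (NRead 0 (NConst 0))) ?body"
  fix s1 assume s1: "nats s1 6 0 = 1" "frame (nset 6 (NConst 1)) s s1"
  show "runs (Seq (rset 10 (RConst 0)) ?w) s1 (30 * l + 15) (\<lambda>s'. reals s' 10 0 = real l)"
  proof (rule runs_Seq[where c = 5 and P = "\<lambda>s'. reals s' 10 0 = 0" and d = "30 * l + 10"])
    fix s2 assume s2: "reals s2 10 0 = 0" "frame (rset 10 (RConst 0)) s1 s2"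
    show "runs ?w s2 (30 * l + 10) (\<lambda>s'. reals s' 10 0 = real l)"
    proof (rule runs_While[where N = l and c = 20
          and I = "\<lambda>i s'. nats s' 6 0 = 2 ^ i \<and> reals s' 10 0 = real i"])
    qed (use s s1 s2 l in \<open>auto intro!: runs_loop_free
        simp: frame_def base_def nwrite_def rwrite_def not_less\<close>)
  qed (auto intro!: runs_loop_free simp: rwrite_def)
qed (auto intro!: runs_loop_free simp: nwrite_def)

section \<open>The invariant of the phases\<close>

text \<open>The output array is known to agree with a candidate only below \<open>n\<close>.\<close>

lemma admissible_cong: "(\<And>v. v < n \<Longrightarrow> x v = y v) \<Longrightarrow> admissible x \<longleftrightarrow> admissible y"
  unfolding admissible_def using Ch_sub
  by (intro conj_cong all_cong1 imp_cong refl arg_cong2[of _ _ _ _ "(\<le>)"] sum.cong) auto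

lemma cost_cong: "(\<And>v. v < n \<Longrightarrow> x v = y v) \<Longrightarrow> cost x = cost y"
  unfolding cost_def by (intro sum.cong) auto

text \<open>The cost bound in \<open>reals s 8 0\<close> plays the part of \<open>\<beta>\<close> in
  \<open>approximation\<close>. Before the first phase there is no candidate; the strict inequality
  ensures that one will be stored.\<close>

definition progress :: "nat \<Rightarrow> mem \<Rightarrow> bool" where
  "progress t s \<longleftrightarrow> base s \<and> reals s 3 = weights start t \<and> reals s 4 0 = b ^ t \<and> reals s 9 0 = b \<and>
     reals s 11 0 = real t \<and> 0 \<le> reals s 8 0 \<and>
     (\<forall>r<t. reals s 8 0 * b ^ r \<le> total (weights start r)) \<and>
     (if t = 0 then total start < reals s 8 0
      else admissible (reals s 2) \<and> cost (reals s 2) \<le> reals s 8 0)"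

lemma save_progress:
  assumes "progress t s"
  shows "runs save_com s (140 * (n * m)) (\<lambda>s'. 0 \<le> reals s' 8 0 \<and>
     (\<forall>r<Suc t. reals s' 8 0 * b ^ r \<le> total (weights start r)) \<and>
     admissible (reals s' 2) \<and> cost (reals s' 2) \<le> reals s' 8 0)"
proof (rule runs_mono[OF save_spec _ order_refl])
  let ?I = "{v. 0 < part v}"
  show s: "base s"
    using assms by (simp add: progress_def)
  have X: "reals s 3 = weights start t" "reals s 4 0 = b ^ t"
    using assms by (auto simp: progress_def)
  have \<alpha>: "0 < b ^ t"
    using b_gt_1 by simp
  have nonneg: "nonneg (weights start t)"
    using weights_nonneg start_nonneg by blast
  have cand: "admissible (candidate ?I (weights start t) (b ^ t))"
    using \<alpha> nonneg weights_feasible[OF start_feasible start_nonneg] part_src part_dst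
    by (intro candidate_admissible) (auto simp: Ch_def)
  fix s' assume s': "if total (reals s 3) < reals s 8 0 * reals s 4 0
    then reals s' 8 0 = total (reals s 3) / reals s 4 0 \<and>
      (\<forall>v<n. reals s' 2 v = candidate ?I (reals s 3) (reals s 4 0) v)
    else reals s' 8 0 = reals s 8 0 \<and> reals s' 2 = reals s 2"
  show "0 \<le> reals s' 8 0 \<and> (\<forall>r<Suc t. reals s' 8 0 * b ^ r \<le> total (weights start r)) \<and>
     admissible (reals s' 2) \<and> cost (reals s' 2) \<le> reals s' 8 0"
  proof (cases "total (weights start t) < reals s 8 0 * b ^ t")
    case True
    then have B: "reals s' 8 0 = total (weights start t) / b ^ t"
      and out: "\<And>v. v < n \<Longrightarrow> reals s' 2 v = candidate ?I (weights start t) (b ^ t) v"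
      using s' X by auto
    \<comment> \<open>Lowering the cost bound preserves the inequalities of earlier phases; that of
      phase \<open>t\<close> becomes an equality.\<close>
    have less: "reals s' 8 0 < reals s 8 0"
      using True \<alpha> by (simp add: B field_simps)
    have "reals s' 8 0 * b ^ r \<le> total (weights start r)" if "r < Suc t" for r
    proof (cases "r = t")
      case False
      then have "reals s 8 0 * b ^ r \<le> total (weights start r)"
        using assms that by (simp add: progress_def)
      moreover have "reals s' 8 0 * b ^ r \<le> reals s 8 0 * b ^ r"
        using less b_gt_1 by (intro mult_right_mono) auto
      ultimately show ?thesis
        by linarith
    qed (use \<alpha> b_gt_1 in \<open>simp add: B\<close>)
    moreover have "0 \<le> reals s' 8 0"
      using nonneg \<alpha> by (simp add: B sum_nonneg)
    ultimately show ?thesis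
      using admissible_cong[OF out] cost_cong[OF out] cand candidate_cost[OF nonneg \<alpha>] B by simp
  next
    case False
    then have "reals s' 8 0 = reals s 8 0" "reals s' 2 = reals s 2"
      using s' X by auto
    \<comment> \<open>For \<open>t = 0\<close> this case contradicts the invariant; otherwise an
      earlier candidate is kept.\<close>
    then show ?thesis
      using assms False by (auto simp: progress_def less_Suc_eq split: if_splits)
  qed
qed

lemma phase_progress:
  assumes "progress t s"
  shows "runs phase_com s (500 * (n * m)) (progress (Suc t))"
  unfolding phase_com_def
proof (rule runs_Seq[OF save_progress[OF assms], where d = "360 * (n * m)"])
  let ?saved = "\<lambda>s'. 0 \<le> reals s' 8 0 \<and>
     (\<forall>r<Suc t. reals s' 8 0 * b ^ r \<le> total (weights start r)) \<and>
     admissible (reals s' 2) \<and> cost (reals s' 2) \<le> reals s' 8 0"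
  fix s1 assume s1: "?saved s1" "frame save_com s s1"
  have s1': "base s1" "reals s1 3 = weights start t" "reals s1 4 0 = b ^ t" "reals s1 9 0 = b"
      "reals s1 11 0 = real t"
    using assms s1(2) by (auto simp: progress_def base_def frame_def com_defs)
  let ?rows = "for_loop 4 0 row_com" and ?tick = "rset 11 (RPlus (rvar 11) (RConst 1))"
  show "runs (Seq (rset 4 (RTimes (rvar 4) (rvar 9))) (Seq ?rows ?tick)) s1 (360 * (n * m))
    (progress (Suc t))"
  proof (rule runs_Seq[where c = 10 and d = "350 * (n * m)" and P = "\<lambda>s'. reals s' 4 0 = b ^ Suc t"])
    fix s2 assume s2: "reals s2 4 0 = b ^ Suc t" "frame (rset 4 (RTimes (rvar 4) (rvar 9))) s1 s2"
    have s2': "base s2" "reals s2 3 = weights start t" "reals s2 9 0 = b" "reals s2 11 0 = real t"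
        "?saved s2"
      using s1 s1' s2(2) by (auto simp: base_def frame_def)
    show "runs (Seq ?rows ?tick) s2 (350 * (n * m)) (progress (Suc t))"
    proof (rule runs_Seq[OF rows_spec[OF s2'(1,3)], where d = 10])
      fix s3 assume s3: "reals s3 3 = rows (reals s2 3) (reals s2 4 0) n" "frame ?rows s2 s3"
      have "base s3" "reals s3 9 0 = b" "reals s3 11 0 = real t" "?saved s3"
          "reals s3 4 0 = b ^ Suc t"
        using s2 s2' s3(2) by (auto simp: base_def frame_def com_defs)
      then show "runs ?tick s3 10 (progress (Suc t))"
        using s3(1) s2 s2' by (intro runs_loop_free) (auto simp: progress_def rwrite_def base_def)
    qed (use n_le in simp)
  qed (use n_le s1' in \<open>auto intro!: runs_loop_free simp: rwrite_def\<close>)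
qed simp

text \<open>The two conditions on \<open>T\<close> say that the loop test first fails after exactly
  \<open>T\<close> phases, so \<open>runs_While\<close> applies with that count.\<close>

lemma phases_spec:
  assumes s: "base s" "reals s 3 = start" "reals s 4 0 = 1" "reals s 9 0 = b"
      "reals s 8 0 = 1 + total start" "reals s 10 0 = real l" "reals s 12 0 = b - 1"
    and b: "b \<le> 7 / 6" and l: "n \<le> 2 ^ l" "1 \<le> l"
    and T: "2 * real l \<le> real T * (b - 1)\<^sup>2" "\<And>t. t < T \<Longrightarrow> real t * (b - 1)\<^sup>2 < 2 * real l"
  shows "runs phases_com s (600 * (n * m) * (T + 1)) (\<lambda>s'. admissible (reals s' 2) \<and>
    (\<forall>z. admissible z \<longrightarrow> cost (reals s' 2) \<le> (1 + 6 * (b - 1)) * cost z))"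
  unfolding phases_com_def
proof (rule runs_Seq[where c = 3 and d = "T * (500 * (n * m) + 30) + 30" and P = "progress 0"])
  let ?test = "RLess (RTimes (rvar 11) (RTimes (rvar 12) (rvar 12))) (RTimes (RConst 2) (rvar 10))"
  let ?J = "\<lambda>t s'. progress t s' \<and> reals s' 10 0 = real l \<and> reals s' 12 0 = b - 1"
  let ?Q = "\<lambda>s'. admissible (reals s' 2) \<and>
    (\<forall>z. admissible z \<longrightarrow> cost (reals s' 2) \<le> (1 + 6 * (b - 1)) * cost z)"
  have T_pos: "0 < T"
    using T(1) l(2) by (cases T) auto
  have keep: "10 \<notin> rmod phase_com" "12 \<notin> rmod phase_com"
    by (auto simp: com_defs)
  fix s1 assume s1: "progress 0 s1" "frame (rset 11 (RConst 0)) s s1"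
  show "runs (While ?test phase_com) s1 (T * (500 * (n * m) + 30) + 30) ?Q"
  proof (rule runs_While[where I = ?J and N = T and c = "500 * (n * m)"])
    show "?J 0 s1"
      using s s1 by (auto simp: frame_def)
  next
    fix t s' assume *: "t < T" "?J t s'" "frame phase_com s1 s'"
    have "runs phase_com s' (500 * (n * m)) (?J (Suc t))"
      using * keep by (intro runs_mono[OF phase_progress]) (auto simp: frame_def)
    moreover have "bval s' ?test"
      using * T(2)[of t] by (simp add: progress_def power2_eq_square)
    ultimately show "bval s' ?test \<and> runs phase_com s' (500 * (n * m)) (?J (Suc t))"
      by simp
  next
    fix s' assume *: "?J T s'" "frame phase_com s1 s'"
    have "reals s' 8 0 \<le> (1 + 6 * (b - 1)) * cost z" if "admissible z" for z
      using * n_pos by (intro approximation[OF that b l(1) _ l(2) T(1)]) (auto simp: progress_def)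
    then have "?Q s'"
      using * T_pos by (auto simp: progress_def intro: order_trans)
    moreover have "\<not> bval s' ?test"
      using * T(1) by (simp add: progress_def power2_eq_square)
    ultimately show "\<not> bval s' ?test \<and> ?Q s'"
      by simp
  qed (simp add: algebra_simps)
next
  show "3 + (T * (500 * (n * m) + 30) + 30) \<le> 600 * (n * m) * (T + 1)"
    using n_pos m_pos by (cases n; cases m) (simp_all add: algebra_simps)
next
  show "runs (rset 11 (RConst 0)) s 3 (progress 0)"
    using s start_nonneg
    by (intro runs_loop_free) (auto simp: progress_def base_def rwrite_def sum_nonneg add_nonneg_nonneg)
qed

lemma solve_spec:
  assumes s: "base s" "reals s 3 = (\<lambda>_. 0)" "reals s 6 0 = 0"
    and b: "b = 1 + min 1 (reals s 0 0) / 6" and l: "n \<le> 2 ^ l" "\<And>i. i < l \<Longrightarrow> 2 ^ i < n" "1 \<le> l"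
    and T: "2 * real l \<le> real T * (b - 1)\<^sup>2" "\<And>t. t < T \<Longrightarrow> real t * (b - 1)\<^sup>2 < 2 * real l"
  shows "runs solve_com s (1000 * (n * m) * (T + 1) + 30 * l) (\<lambda>s'. admissible (reals s' 2) \<and>
    (\<forall>z. admissible z \<longrightarrow> cost (reals s' 2) \<le> (1 + 6 * (b - 1)) * cost z))"
  (is "runs _ _ _ ?Q")
  unfolding solve_com_def
proof (rule runs_Seq[where c = 40
    and P = "\<lambda>s'. reals s' 12 0 = b - 1 \<and> reals s' 9 0 = b \<and> reals s' 4 0 = 1"
    and d = "200 * (n * m) + (60 * (n * m) + ((30 * l + 20) + 600 * (n * m) * (T + 1)))"])
  let ?P = "\<lambda>s'. reals s' 12 0 = b - 1 \<and> reals s' 9 0 = b \<and> reals s' 4 0 = 1"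
  show "runs setup_com s 40 ?P"
    using b by (intro runs_loop_free) (auto simp: setup_com_def rwrite_def of_rat_divide)
  fix s1 assume s1: "?P s1" "frame setup_com s s1"
  have s1': "base s1" "reals s1 3 = (\<lambda>_. 0)" "reals s1 4 0 = 1" "reals s1 6 0 = 0"
    using s s1 by (auto simp: frame_def base_def com_defs)
  show "runs (Seq max_excess_com (Seq start_com (Seq log_com phases_com))) s1
     (200 * (n * m) + (60 * (n * m) + ((30 * l + 20) + 600 * (n * m) * (T + 1)))) ?Q"
  proof (rule runs_Seq[OF max_excess_spec[OF s1'] _ order_refl])
    fix s2 assume s2: "reals s2 6 0 = max_excess n" "frame max_excess_com s1 s2"
    have s2': "base s2" "reals s2 3 = (\<lambda>_. 0)" "?P s2"
      using s1 s1' s2 by (auto simp: frame_def base_def com_defs)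
    show "runs (Seq start_com (Seq log_com phases_com)) s2
       (60 * (n * m) + ((30 * l + 20) + 600 * (n * m) * (T + 1))) ?Q"
    proof (rule runs_Seq[OF start_spec[OF s2'(1,2) s2(1)] _ order_refl])
      let ?R = "\<lambda>s'. reals s' 3 = start \<and> reals s' 8 0 = 1 + total start"
      fix s3 assume s3: "?R s3" "frame start_com s2 s3"
      have s3': "base s3" "?P s3"
        using s2' s3(2) by (auto simp: frame_def base_def com_defs)
      show "runs (Seq log_com phases_com) s3 ((30 * l + 20) + 600 * (n * m) * (T + 1)) ?Q"
      proof (rule runs_Seq[OF log_spec[OF s3'(1) l(1,2)] _ order_refl])
        fix s4 assume s4: "reals s4 10 0 = real l" "frame log_com s3 s4"
        have s4': "base s4" "?P s4" "?R s4"
          using s3 s3' s4(2) by (auto simp: frame_def base_def com_defs)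
        show "runs phases_com s4 (600 * (n * m) * (T + 1)) ?Q"
          using s4 s4' l T b by (intro phases_spec) auto
      qed
    qed
  qed
next
  show "40 + (200 * (n * m) + (60 * (n * m) + ((30 * l + 20) + 600 * (n * m) * (T + 1))))
      \<le> 1000 * (n * m) * (T + 1) + 30 * l"
    using n_pos m_pos by (cases n; cases m) (simp_all add: algebra_simps)
qed

end

lemma copy_spec:
  assumes "nats s 0 0 = n"
  shows "runs copy_com s (n * 30 + 12) (\<lambda>s'. \<forall>v<n. reals s' 2 v = reals s 1 v)"
  unfolding copy_com_def
proof (rule runs_for_loop[where N = n and d = 18
      and I = "\<lambda>i s'. \<forall>v<i. reals s' 2 v = reals s 1 v"])
qed (use assms in \<open>auto intro!: runs_loop_free
    simp: frame_def nwrite_def rwrite_def less_Suc_eq\<close>)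

section \<open>From vertices to positions\<close>

locale encoded =
  fixes U W :: "nat set" and E :: "(nat \<times> nat) set" and a :: "nat \<Rightarrow> real" and \<epsilon> :: real
    and vs :: "nat list" and es :: "(nat \<times> nat) list"
  assumes graph: "bilayered U W E" and weights_nonneg: "\<And>v. v \<in> U \<union> W \<Longrightarrow> 0 \<le> a v"
    and \<epsilon>_pos: "0 < \<epsilon>" and enc: "encodes vs es U W E"
begin

abbreviation "n \<equiv> length vs"

abbreviation "m \<equiv> length es"

lemma vs: "distinct vs" "set vs = U \<union> W"
  using enc by (auto simp: encodes_def)

lemma edges: "distinct es" "set es \<subseteq> {..<n} \<times> {..<n}"
  "E = (\<lambda>(i, j). (vs ! i, vs ! j)) ` set es"
  using enc by (auto simp: encodes_def)

lemma bij_nth: "bij_betw ((!) vs) {..<n} (U \<union> W)"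
  using vs bij_betw_nth[of vs "{..<n}"] by simp

lemma inj_nth: "inj_on ((!) vs) {..<n}"
  using bij_nth bij_betw_def by blast

lemma card_V: "card (U \<union> W) = n"
  using vs distinct_card by metis

lemma card_E: "card E = m"
proof -
  have "inj_on (\<lambda>(i, j). (vs ! i, vs ! j)) (set es)"
    using inj_on_subset[OF map_prod_inj_on[OF inj_nth inj_nth] edges(2)]
    by (simp add: map_prod_def)
  then show ?thesis
    using edges distinct_card card_image by metis
qed

definition unindex :: "(nat \<Rightarrow> real) \<Rightarrow> nat \<Rightarrow> real" where
  "unindex y v = y (the_inv_into {..<n} ((!) vs) v)"

lemma unindex_nth: "i < n \<Longrightarrow> unindex y (vs ! i) = y i"
  using the_inv_into_f_f[OF inj_nth] by (simp add: unindex_def)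

lemma l1_dist_nth: "l1_dist (U \<union> W) x a = (\<Sum>i<n. \<bar>x (vs ! i) - a (vs ! i)\<bar>)"
  unfolding l1_dist_def by (rule sum.reindex_bij_betw[OF bij_nth, symmetric])

definition weight :: "nat \<Rightarrow> real" where
  "weight = load 0 (map a vs)"

definition source :: "nat \<Rightarrow> nat" where
  "source = load 0 (map fst es)"

definition target :: "nat \<Rightarrow> nat" where
  "target = load 0 (map snd es)"

definition side :: "nat \<Rightarrow> nat" where
  "side = load 0 (map (\<lambda>v. if v \<in> U then 1 else 0) vs)"

lemma weight_nth: "i < n \<Longrightarrow> weight i = a (vs ! i)"
  by (simp add: weight_def load_def)

lemma edge_nth:
  assumes "k < m"
  shows "es ! k = (source k, target k)" "source k < n" "target k < n"
    "vs ! source k \<in> U" "vs ! target k \<in> W"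
proof -
  show eq: "es ! k = (source k, target k)"
    using assms by (simp add: source_def target_def load_def)
  then have mem: "(source k, target k) \<in> set es"
    using nth_mem[OF assms] by simp
  then show "source k < n" "target k < n"
    using edges(2) by auto
  have "(vs ! source k, vs ! target k) \<in> E"
    unfolding edges(3) using mem by (rule rev_image_eqI) simp
  then show "vs ! source k \<in> U" "vs ! target k \<in> W"
    using graph by (auto simp: bilayered_def)
qed

lemma side_nth: "i < n \<Longrightarrow> side i = (if vs ! i \<in> U then 1 else 0)"
  by (simp add: side_def load_def)

definition base_factor :: real where
  "base_factor = 1 + min 1 \<epsilon> / 6"

context
  assumes nonempty: "es \<noteq> []"
begin

interpretation loaded n m source target side weight base_factor
proof
  have disj: "v \<notin> U" if "v \<in> W" for v
    using graph that by (auto simp: bilayered_def)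
  fix k assume k: "k < m"
  show "source k < n" "target k < n" "side (source k) = 1" "side (target k) = 0"
    using edge_nth[OF k] disj by (auto simp: side_nth)
  fix l assume "l < m" "source k = source l" "target k = target l"
  then show "k = l"
    using edge_nth(1) k edges(1) nth_eq_iff_index_eq by metis
next
  fix i assume "i < n"
  then show "0 \<le> weight i"
    using weights_nonneg vs nth_mem by (auto simp: weight_nth)
qed (use \<epsilon>_pos nonempty in \<open>auto simp: base_factor_def\<close>)

lemma children_nth:
  assumes "j < n"
  shows "children U E (vs ! j) = (!) vs ` Ch j"
proof
  show "children U E (vs ! j) \<subseteq> (!) vs ` Ch j"
  proof
    fix u assume "u \<in> children U E (vs ! j)"
    then obtain i j' where ij: "(i, j') \<in> set es" "u = vs ! i" "vs ! j = vs ! j'"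
      using edges(3) by (auto simp: children_def)
    then obtain k where k: "k < m" "es ! k = (i, j')"
      by (meson in_set_conv_nth)
    then have "source k = i" "target k = j'"
      using edge_nth(1) by auto
    moreover have "j' = j"
      using ij edges(2) assms vs(1) by (auto simp: nth_eq_iff_index_eq)
    ultimately show "u \<in> (!) vs ` Ch j"
      using k ij by (auto simp: Ch_def)
  qed
  show "(!) vs ` Ch j \<subseteq> children U E (vs ! j)"
  proof
    fix u assume "u \<in> (!) vs ` Ch j"
    then obtain k where k: "k < m" "target k = j" "u = vs ! source k"
      by (auto simp: Ch_def)
    then have "(source k, j) \<in> set es"
      using edge_nth(1) nth_mem by metis
    then show "u \<in> children U E (vs ! j)"
      using edges(3) edge_nth(4)[OF k(1)] k(3) by (force simp: children_def)
  qed
qed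

text \<open>Vertices of \<open>U\<close> have no children, so imposing the parent constraint on them
  as well only repeats nonnegativity.\<close>

lemma valid_iff_admissible: "valid U W E x \<longleftrightarrow> admissible (\<lambda>i. x (vs ! i))"
proof -
  have all: "(\<forall>v\<in>U \<union> W. P v) \<longleftrightarrow> (\<forall>i<n. P (vs ! i))" for P
    using vs(2) by (metis all_set_conv_all_nth)
  have sums: "sum x (children U E (vs ! j)) = (\<Sum>i\<in>Ch j. x (vs ! i))" if "j < n" for j
    using inj_on_subset[OF inj_nth Ch_sub] by (simp add: children_nth[OF that] sum.reindex)
  have no_children: "children U E v = {}" if "v \<in> U" for v
    using graph that by (auto simp: children_def bilayered_def)
  have "valid U W E x \<longleftrightarrow> (\<forall>v\<in>U \<union> W. 0 \<le> x v) \<and> (\<forall>v\<in>U \<union> W. sum x (children U E v) \<le> x v)"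
    using no_children by (auto simp: valid_def)
  then show ?thesis
    unfolding all admissible_def using sums by auto
qed

lemma l1_dist_eq_cost: "l1_dist (U \<union> W) x a = cost (\<lambda>i. x (vs ! i))"
  by (simp add: l1_dist_nth cost_def weight_nth)

section \<open>The guarantee for graphs with edges\<close>

lemma algorithm_nonempty:
  "runs algorithm (input vs es U a \<epsilon>)
     (nat \<lfloor>300000 * (real n * real m * ln (real n) / (min 1 \<epsilon>)\<^sup>2)\<rfloor>)
     (\<lambda>s. valid U W E (unindex (reals s 2)) \<and>
       l1_dist (U \<union> W) (unindex (reals s 2)) a \<le> (1 + \<epsilon>) * opt U W E a)"
proof -
  define \<mu> where "\<mu> = min 1 \<epsilon>"
  have \<mu>: "0 < \<mu>" "\<mu> \<le> 1"
    using \<epsilon>_pos by (auto simp: \<mu>_def)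
  have b: "base_factor - 1 = \<mu> / 6" "base_factor \<le> 7 / 6"
    by (auto simp: base_factor_def \<mu>_def)
  \<comment> \<open>An edge has two different end points. This keeps \<open>ln n\<close> away from
    0, so that additive constants can be absorbed.\<close>
  have n2: "2 \<le> n"
    using src_less[OF m_pos] dst_less[OF m_pos] src_neq_dst[OF m_pos m_pos] by linarith
  define l where "l = (LEAST l. n \<le> 2 ^ l)"
  have l: "n \<le> 2 ^ l" "\<And>i. i < l \<Longrightarrow> 2 ^ i < n"
    using LeastI[of "\<lambda>l. n \<le> 2 ^ l" n] not_less_Least[of _ "\<lambda>l. n \<le> 2 ^ l"]
      less_imp_le[OF less_exp[of n]] by (auto simp: l_def not_le)
  have l1: "1 \<le> l"
    using l(1) n2 by (cases l) auto
  have ln_2: "1 / 2 \<le> ln (2::real)"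
    using ln_le_minus_one[of "1 / 2 :: real"] by (simp add: ln_div)
  moreover have "ln 2 \<le> ln (real n)"
    using n2 by (intro ln_mono) auto
  ultimately have ln_n: "1 / 2 \<le> ln (real n)"
    by linarith
  have "2 ^ (l - 1) < n"
    using l(2) l1 by simp
  then have "ln (2 ^ (l - 1)) \<le> ln (real n)"
    by (intro ln_mono) (auto simp flip: of_nat_power)
  then have "real (l - 1) * ln 2 \<le> ln (real n)"
    by (simp add: ln_realpow)
  moreover have "real (l - 1) * (1 / 2) \<le> real (l - 1) * ln 2"
    using ln_2 by (intro mult_left_mono) auto
  \<comment> \<open>Both \<open>l - 1\<close> and \<open>1\<close> are at most
    \<open>2 * ln n\<close>.\<close>
  ultimately have l_le: "real l \<le> 4 * ln n"
    using l1 ln_n by (simp add: of_nat_diff)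
  have "0 < (\<mu> / 6)\<^sup>2"
    using \<mu>(1) by simp
  then obtain T0 where "2 * real l < real T0 * (\<mu> / 6)\<^sup>2"
    using reals_Archimedean3 by blast
  then have "2 * real l \<le> real T0 * (\<mu> / 6)\<^sup>2"
    by simp
  define T where "T = (LEAST t. 2 * real l \<le> real t * (\<mu> / 6)\<^sup>2)"
  have T: "2 * real l \<le> real T * (\<mu> / 6)\<^sup>2"
    unfolding T_def by (rule LeastI) fact
  have T_least: "real t * (\<mu> / 6)\<^sup>2 < 2 * real l" if "t < T" for t
    using not_less_Least[OF that[unfolded T_def]] by simp
  have T_pos: "0 < T"
    using T l1 by (cases T) auto
  have "(real T - 1) * (\<mu> / 6)\<^sup>2 < 2 * real l"
    using T_least[of "T - 1"] T_pos by (simp add: of_nat_diff)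
  moreover have "\<mu>\<^sup>2 \<le> 1"
    using \<mu> by (simp add: power_le_one)
  \<comment> \<open>Minimality of \<open>T\<close> gives \<open>(T - 1) * \<mu>^2 < 72 * l\<close>;
    the remaining \<open>2 * \<mu>^2\<close> is at most \<open>2 * l\<close>.\<close>
  ultimately have "(real T + 1) * \<mu>\<^sup>2 \<le> 74 * real l"
    using l1 by (simp add: power_divide algebra_simps)
  also have "\<dots> \<le> 296 * ln n"
    using l_le by simp
  finally have T_le: "real T + 1 \<le> 296 * (ln n / \<mu>\<^sup>2)"
    using \<mu>(1) by (simp add: field_simps)
  let ?s = "input vs es U a \<epsilon>"
  let ?Q = "\<lambda>s. admissible (reals s 2) \<and>
    (\<forall>z. admissible z \<longrightarrow> cost (reals s 2) \<le> (1 + 6 * (base_factor - 1)) * cost z)"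
  have s: "base ?s" "reals ?s 3 = (\<lambda>_. 0)" "reals ?s 6 0 = 0" "reals ?s 0 0 = \<epsilon>"
    unfolding base_def
    by (simp_all add: input_def source_def target_def side_def weight_def load_def
        fun_eq_iff numeral_2_eq_2 numeral_3_eq_3)
  have "runs solve_com ?s (1000 * (n * m) * (T + 1) + 30 * l) ?Q"
    using s l l1 T T_least by (intro solve_spec) (simp_all add: b(1), simp add: base_factor_def)
  moreover have "bval ?s (NLess (NConst 0) (NRead 0 (NConst 1)))"
    using s(1) m_pos by (simp add: base_def)
  ultimately have run: "runs algorithm ?s (1000 * (n * m) * (T + 1) + 30 * l + 10) ?Q"
    unfolding algorithm_def by (intro runs_Cond) auto
  show ?thesis
  proof (rule runs_mono[OF run])
    fix s :: mem assume Q: "?Q s"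
    have idx: "unindex (reals s 2) (vs ! i) = reals s 2 i" if "i < n" for i
      using unindex_nth[OF that] .
    have "valid U W E (unindex (reals s 2))"
      using Q admissible_cong[OF idx] by (simp add: valid_iff_admissible)
    \<comment> \<open>Dividing by \<open>1 + \<epsilon>\<close> makes the claim a lower bound for
      the distances of all valid vectors, hence for their infimum, attained or not.\<close>
    moreover have "l1_dist (U \<union> W) (unindex (reals s 2)) a / (1 + \<epsilon>) \<le> opt U W E a"
      unfolding opt_def
    proof (rule cINF_greatest)
      fix z assume z: "z \<in> {x. valid U W E x}"
      have "l1_dist (U \<union> W) (unindex (reals s 2)) a = cost (reals s 2)"
        using cost_cong[OF idx] by (simp add: l1_dist_eq_cost)
      also have "\<dots> \<le> (1 + 6 * (base_factor - 1)) * l1_dist (U \<union> W) z a"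
        using Q z by (simp add: valid_iff_admissible l1_dist_eq_cost)
      also have "\<dots> \<le> (1 + \<epsilon>) * l1_dist (U \<union> W) z a"
        by (intro mult_right_mono) (auto simp: base_factor_def l1_dist_def intro: sum_nonneg)
      finally show "l1_dist (U \<union> W) (unindex (reals s 2)) a / (1 + \<epsilon>) \<le> l1_dist (U \<union> W) z a"
        using \<epsilon>_pos by (simp add: field_simps)
    qed (use valid_zero in auto)
    ultimately show "valid U W E (unindex (reals s 2)) \<and>
        l1_dist (U \<union> W) (unindex (reals s 2)) a \<le> (1 + \<epsilon>) * opt U W E a"
      using \<epsilon>_pos by (simp add: field_simps)
  next
    define N L where "N = real (n * m)" and "L = ln n / \<mu>\<^sup>2"
    have N: "1 \<le> N"
      using of_nat_mono[OF n_le(2), where 'a = real] by (simp add: N_def)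
    have "ln n * \<mu>\<^sup>2 \<le> ln n"
      using ln_n \<mu> by (intro mult_left_le power_le_one) auto
    then have "ln n \<le> L"
      using \<mu>(1) by (simp add: L_def pos_le_divide_eq)
    then have L: "1 / 2 \<le> L" "real l \<le> 4 * L"
      using ln_n l_le by linarith+
    then have NL: "L \<le> N * L"
      using N mult_right_mono[of 1 N L] by simp
    have "real (1000 * (n * m) * (T + 1) + 30 * l + 10)
        = 1000 * N * (real T + 1) + (30 * real l + 10)"
      by (simp add: N_def algebra_simps)
    also have "\<dots> \<le> 1000 * N * (296 * L) + 140 * L"
    proof (rule add_mono)
      show "1000 * N * (real T + 1) \<le> 1000 * N * (296 * L)"
        using T_le N by (intro mult_left_mono) (simp_all add: L_def)
      show "30 * real l + 10 \<le> 140 * L"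
        using L by linarith
    qed
    also have "\<dots> = 296000 * (N * L) + 140 * L"
      by simp
    also have "\<dots> \<le> 300000 * (N * L)"
      using NL L(1) by linarith
    also have "\<dots> = 300000 * (real n * real m * ln n / \<mu>\<^sup>2)"
      by (simp add: N_def L_def)
    finally show "1000 * (n * m) * (T + 1) + 30 * l + 10
        \<le> nat \<lfloor>300000 * (real n * real m * ln (real n) / (min 1 \<epsilon>)\<^sup>2)\<rfloor>"
      unfolding \<mu>_def by (rule le_nat_floor)
  qed
qed

end

section \<open>Graphs without edges\<close>

lemma opt_nonneg: "0 \<le> opt U W E a"
  unfolding opt_def using valid_zero
  by (intro cINF_greatest) (auto simp: l1_dist_def intro: sum_nonneg)

text \<open>Without edges \<open>a\<close> itself is valid, so copying it gives distance 0.\<close>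

lemma algorithm_empty:
  assumes "es = []"
  shows "runs algorithm (input vs es U a \<epsilon>) (30 * (1 + n))
     (\<lambda>s. valid U W E (unindex (reals s 2)) \<and>
       l1_dist (U \<union> W) (unindex (reals s 2)) a \<le> (1 + \<epsilon>) * opt U W E a)"
proof -
  let ?s = "input vs es U a \<epsilon>"
  have s: "nats ?s 0 0 = n" "nats ?s 0 1 = 0" "reals ?s 1 = weight"
    using assms by (simp_all add: input_def load_def weight_def fun_eq_iff)
  have E: "E = {}"
    using assms edges(3) by simp
  have "runs copy_com ?s (30 * n + 12) (\<lambda>s. valid U W E (unindex (reals s 2)) \<and>
       l1_dist (U \<union> W) (unindex (reals s 2)) a \<le> (1 + \<epsilon>) * opt U W E a)"
  proof (rule runs_mono[OF copy_spec[OF s(1)]])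
    fix s assume "\<forall>v<n. reals s 2 v = reals ?s 1 v"
    then have out: "unindex (reals s 2) (vs ! i) = a (vs ! i)" if "i < n" for i
      using that s(3) by (simp add: unindex_nth weight_nth)
    then have "unindex (reals s 2) v = a v" if "v \<in> U \<union> W" for v
      using that vs(2) by (metis in_set_conv_nth)
    then have "valid U W E (unindex (reals s 2))"
      using weights_nonneg by (auto simp: valid_def children_def E)
    moreover have "l1_dist (U \<union> W) (unindex (reals s 2)) a = 0"
      using out by (simp add: l1_dist_nth)
    ultimately show "valid U W E (unindex (reals s 2)) \<and>
        l1_dist (U \<union> W) (unindex (reals s 2)) a \<le> (1 + \<epsilon>) * opt U W E a"
      using opt_nonneg \<epsilon>_pos by simp
  qed simp
  then show ?thesis
    unfolding algorithm_def using s(2) by (intro runs_Cond) auto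
qed

lemma outputs_unindex: "outputs s vs (unindex (reals s 2))"
  by (simp add: outputs_def unindex_nth)

end

text \<open>Without edges the product in the time bound vanishes, so that case has its own linear
  bound. The accuracy enters as \<open>min 1 \<epsilon>\<close>, the value with which the program
  computes.\<close>

theorem theorem7:
  shows "\<exists>(p :: com) (C :: real).
    \<forall>(U :: nat set) (W :: nat set) (E :: (nat \<times> nat) set) (a :: nat \<Rightarrow> real) (\<epsilon> :: real)
      (vs :: nat list) (es :: (nat \<times> nat) list).
      bilayered U W E \<longrightarrow> (\<forall>v \<in> U \<union> W. a v \<ge> 0) \<longrightarrow> \<epsilon> > 0 \<longrightarrow> encodes vs es U W E \<longrightarrow>
      (\<exists>t s x. exec p (input vs es U a \<epsilon>) t s \<and> outputs s vs x \<and>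
        valid U W E x \<and>
        l1_dist (U \<union> W) x a \<le> (1 + \<epsilon>) * opt U W E a \<and>
        (E \<noteq> {} \<longrightarrow>
          real t \<le> C * (real (card (U \<union> W)) * real (card E) * ln (real (card (U \<union> W))) / (min 1 \<epsilon>)\<^sup>2)) \<and>
        (E = {} \<longrightarrow> real t \<le> C * (1 + real (card (U \<union> W)))))"
proof (rule exI[of _ algorithm], rule exI[of _ 300000], intro allI impI)
  fix U W :: "nat set" and E and a :: "nat \<Rightarrow> real" and \<epsilon> :: real
    and vs :: "nat list" and es
  assume "bilayered U W E" "\<forall>v \<in> U \<union> W. a v \<ge> 0" "\<epsilon> > 0" "encodes vs es U W E"
  then interpret encoded U W E a \<epsilon> vs es
    by unfold_locales auto
  have E: "E = {} \<longleftrightarrow> es = []"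
    using edges(3) by simp
  define c where "c = (if E = {} then 30 * (1 + n)
    else nat \<lfloor>300000 * (real n * real m * ln (real n) / (min 1 \<epsilon>)\<^sup>2)\<rfloor>)"
  obtain t s where t: "exec algorithm (input vs es U a \<epsilon>) t s" "t \<le> c"
      "valid U W E (unindex (reals s 2))"
      "l1_dist (U \<union> W) (unindex (reals s 2)) a \<le> (1 + \<epsilon>) * opt U W E a"
    using algorithm_empty algorithm_nonempty E by (auto simp: runs_def c_def split: if_splits)
  have "real t \<le> 300000 * (real n * real m * ln (real n) / (min 1 \<epsilon>)\<^sup>2)" if "E \<noteq> {}"
  proof -
    have "1 \<le> real n"
      using that edges by (cases vs) auto
    then have "0 \<le> 300000 * (real n * real m * ln (real n) / (min 1 \<epsilon>)\<^sup>2)"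
      by (intro mult_nonneg_nonneg divide_nonneg_nonneg) auto
    then have "real c \<le> 300000 * (real n * real m * ln (real n) / (min 1 \<epsilon>)\<^sup>2)"
      using that by (simp add: c_def of_nat_floor)
    then show ?thesis
      using t(2) by linarith
  qed
  moreover have "real t \<le> 300000 * (1 + real n)" if "E = {}"
    using t(2) that by (simp add: c_def)
  ultimately show "\<exists>t s x. exec algorithm (input vs es U a \<epsilon>) t s \<and> outputs s vs x \<and>
        valid U W E x \<and>
        l1_dist (U \<union> W) x a \<le> (1 + \<epsilon>) * opt U W E a \<and>
        (E \<noteq> {} \<longrightarrow>
          real t \<le> 300000 * (real (card (U \<union> W)) * real (card E) * ln (real (card (U \<union> W))) / (min 1 \<epsilon>)\<^sup>2)) \<and>
        (E = {} \<longrightarrow> real t \<le> 300000 * (1 + real (card (U \<union> W))))"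
    using t outputs_unindex unfolding card_V card_E by blast
qed

end
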